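(* Let $N\ge 1$ be an integer, $s\in(0,1)$, $p\ge 1$, $\beta>0$, and let $\psi(x):=(1+|x|^2)^{-\beta/2}$ for $x\in\mathbb{R}^N$. Let $\rho\in C(\mathbb{R}^N)$ with $\rho(x)>0$ for all $x\in\mathbb{R}^N$, and suppose that there exist $K>0$ and $\alpha\in\mathbb{R}$ such that $\rho(x)\ge K(1+|x|^2)^{-\alpha/2}$ for all $x\in\mathbb{R}^N$ (this lower bound is replaced by another one in the second alternative of (iii) below). Let $c\in C(\mathbb{R}^N)$, $c\geq 0$, and suppose that for some $c_0>0$ one has $c(x)\ge c_0$ for all $x\in\mathbb{R}^N$. Let $u$ be a solution to the equation $$(-\Delta)^s u+\rho\, c\, u=0\quad\text{in }\mathbb{R}^N$$ with $|u|^p\in\mathcal{L}^s(\mathbb{R}^N)$. If $u\in L^p_\psi(\mathbb{R}^N)$, then $u\equiv0$ in $\mathbb{R}^N$, provided that one of the following conditions holds: (i) $0<\beta\le N-2s$, $\alpha\in\mathbb{R}$; (ii) $N-2s<\beta<N$, $\alpha\le 2s$; (iii) $\beta=N$, and either $\alpha<2s$, or, instead of the lower bound $\rho(x)\ge K(1+|x|^2)^{-\alpha/2}$, there holds $\rho(x)\ge K(1+|x|^2)^{-s}\log(1+|x|^2)$ for all $x\in\mathbb{R}^N$, for some $K>0$; (iv) $\beta>N$, $\alpha+\beta\le 2s+N$; and, in addition, when (ii) or (iii) or (iv) is the condition that holds, $p\,c_0K$ is large enough, i.e. $p\,c_0K>\Lambda$ for a suitable constant $\Lambda>0$ depending only on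 $N,s,\alpha,\beta$.
   Context: $\mathcal{L}^s(\mathbb{R}^N)$ is the space of measurable $v:\mathbb{R}^N\to\mathbb{R}$ with $\int_{\mathbb{R}^N}\frac{|v(x)|}{1+|x|^{N+2s}}\,dx<\infty$. For a positive continuous weight $\psi$, $L^p_\psi(\mathbb{R}^N)$ is the set of measurable $u:\mathbb{R}^N\to\mathbb{R}$ with $\int_{\mathbb{R}^N}|u|^p\psi\,dx<\infty$. The fractional Laplacian is $(-\Delta)^s v(x)=C_{N,s}\,\mathrm{P.V.}\int_{\mathbb{R}^N}\frac{v(x)-v(y)}{|x-y|^{N+2s}}\,dy$, with $C_{N,s}=\left(\int_{\mathbb{R}^N}\frac{1-\cos(\xi_1)}{|\xi|^{N+2s}}d\xi\right)^{-1}>0$. A function $u$ is a solution to $(-\Delta)^s u+\rho cu=0$ in $\mathbb{R}^N$ if, for some $\gamma>0$, $u\in\mathcal{L}^s(\mathbb{R}^N)\cap C^{2s+\gamma}(\mathbb{R}^N)$ if $s<\frac12$, or $u\in\mathcal{L}^s(\mathbb{R}^N)\cap C^{1,2s+\gamma-1}_{loc}(\mathbb{R}^N)$ if $s\ge\frac12$, and $C_{N,s}\,\mathrm{P.V.}\int_{\mathbb{R}^N}\frac{u(x)-u(y)}{|x-y|^{N+2s}}dy+\rho(x)c(x)u(x)=0$ for all $x\in\mathbb{R}^N$. *)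

theory Defs
  imports "HOL-Analysis.Analysis"
begin

definition weighted_int :: "real \<Rightarrow> (real^'n \<Rightarrow> real) set" where
  "weighted_int s = {v \<in> borel_measurable lebesgue.
     integrable lebesgue (\<lambda>x. \<bar>v x\<bar> / (1 + norm x powr (real CARD('n) + 2 * s)))}"

definition weighted_Lp :: "real \<Rightarrow> (real^'n \<Rightarrow> real) \<Rightarrow> (real^'n \<Rightarrow> real) set" where
  "weighted_Lp p \<psi> = {u \<in> borel_measurable lebesgue.
     integrable lebesgue (\<lambda>x. \<bar>u x\<bar> powr p * \<psi> x)}"

definition poly_weight :: "real \<Rightarrow> real^'n \<Rightarrow> real" where
  "poly_weight \<beta> x = (1 + (norm x)\<^sup>2) powr (- \<beta> / 2)"

(* By rotation invariance the choice of the coordinate playing the role of xi_1 is immaterial;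
   the finite index type 'n carries no distinguished first element. *)
definition frac_const :: "'n::finite itself \<Rightarrow> real \<Rightarrow> real" where
  "frac_const _ s = inverse (LINT \<xi>::real^'n|lebesgue.
     (1 - cos (\<xi> $ (SOME i. True))) / norm \<xi> powr (real CARD('n) + 2 * s))"

(* The principal value is the limit, as eps tends to 0 from above, of the integrals over
   {y. eps < |x - y|}; the predicate asserts that the limit exists.  For v in weighted_int s the
   truncated integrals converge absolutely. *)
definition has_frac_laplacian :: "real \<Rightarrow> (real^'n \<Rightarrow> real) \<Rightarrow> real^'n \<Rightarrow> real \<Rightarrow> bool" where
  "has_frac_laplacian s v x l \<longleftrightarrow>
     ((\<lambda>\<epsilon>. frac_const TYPE('n) s *
        (LINT y:{y. \<epsilon> < dist x y}|lebesgue.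
           (v x - v y) / norm (x - y) powr (real CARD('n) + 2 * s)))
      \<longlongrightarrow> l) (at_right 0)"

definition holder_on :: "real \<Rightarrow> 'a::metric_space set \<Rightarrow> ('a \<Rightarrow> 'b::metric_space) \<Rightarrow> bool" where
  "holder_on \<sigma> S f \<longleftrightarrow> (\<exists>C. \<forall>x\<in>S. \<forall>y\<in>S. dist (f x) (f y) \<le> C * dist x y powr \<sigma>)"

definition C1_holder_loc :: "real \<Rightarrow> (real^'n \<Rightarrow> real) \<Rightarrow> bool" where
  "C1_holder_loc \<tau> u \<longleftrightarrow>
     (\<exists>g. (\<forall>x. GDERIV u x :> g x) \<and> (\<forall>S. compact S \<longrightarrow> holder_on \<tau> S g))"

(* Exponents are kept in (0, 1], where the Hoelder condition has its usual meaning.  This loses no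
   solution: a C^{1,tau}_loc function satisfies the condition for every smaller exponent, and a
   function with finite C^{2s+gamma} norm, for any gamma > 0, is uniformly Hoelder with
   exponent min(2s+gamma, 1).  For s < 1/2 the condition is uniform on the whole space, but u
   itself is not required to be bounded. *)
definition is_solution ::
  "real \<Rightarrow> (real^'n \<Rightarrow> real) \<Rightarrow> (real^'n \<Rightarrow> real) \<Rightarrow> (real^'n \<Rightarrow> real) \<Rightarrow> bool" where
  "is_solution s \<rho> c u \<longleftrightarrow>
     u \<in> weighted_int s \<and>
     (\<exists>\<gamma>>0. if s < 1/2 then 2 * s + \<gamma> \<le> 1 \<and> holder_on (2 * s + \<gamma>) UNIV u
             else 2 * s + \<gamma> - 1 \<le> 1 \<and> C1_holder_loc (2 * s + \<gamma> - 1) u) \<and>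
     (\<forall>x. \<exists>l. has_frac_laplacian s u x l \<and> l + \<rho> x * c x * u x = 0)"

end

theory Submission
  imports Defs
begin

text \<open>
  Write \<open>N\<close> for the dimension, \<open>a = N + 2 s\<close>, \<open>w = |u|^p\<close>, and \<open>C\<close> for the normalising constant of
  the fractional Laplacian.  The idea is to show that \<open>w\<close> tends to zero at infinity and to
  conclude by the maximum principle.

  By convexity of \<open>t \<mapsto> |t|^p\<close> (Kato's inequality, \<open>trunc_lap_Kato\<close>), \<open>w\<close> is a nonnegative
  subsolution: \<open>PV \<integral> (w(x) - w(y)) |x - y|^(-a) dy + \<mu>(x) w(x) \<le> 0\<close> with \<open>\<mu> = p \<rho> c / C > 0\<close>.
  The heart of the proof is a local bound for such subsolutions (\<open>subsolution_local_bound\<close>):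
  in every ball of centre \<open>x\<close> and radius \<open>R\<close> there is a point \<open>y\<^sub>0\<close> with
  \<open>(\<mu>(y\<^sub>0) + R^(-2s)) w(x) \<le> const * \<integral> w(y) (R + |x - y|)^(-a) dy\<close>.
  To see this, let \<open>q(y) = 1 - |x - y|\<^sup>2 / R\<^sup>2\<close> and let \<open>y\<^sub>0\<close> maximise \<open>w q^a\<close> on the ball.  Near \<open>y\<^sub>0\<close>
  the function \<open>w\<close> lies below a multiple of \<open>q^(-a)\<close> and touches it at \<open>y\<^sub>0\<close>, so that the part of the
  singular integral over \<open>|y - y\<^sub>0| \<le> r = \<theta> R q(y\<^sub>0)\<close> is at least a small multiple of \<open>- r^(-2s) w(y\<^sub>0)\<close>.
  The term \<open>w(y\<^sub>0)\<close> in the part over \<open>|y - y\<^sub>0| > r\<close> contributes a fixed multiple of \<open>r^(-2s) w(y\<^sub>0)\<close>,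
  which wins if \<open>\<theta>\<close> is small.  What remains is the integral of \<open>w(y) |y - y\<^sub>0|^(-a)\<close> over
  \<open>|y - y\<^sub>0| > r\<close>, and the exponent of \<open>q\<close> exactly compensates the factor \<open>(r / R)^(-a)\<close> lost there.

  Now take \<open>R = |x| / 2\<close>.  If \<open>w (1 + |y|)^(-b)\<close> is integrable with \<open>0 < b \<le> a\<close>, the right-hand side
  is \<open>o(R^(b - a))\<close> by dominated convergence.  For \<open>\<beta> \<le> N\<close>, which covers (i), (ii) and (iii), put
  \<open>b = \<beta>\<close>: the term \<open>R^(-2s)\<close> on the left gives \<open>w(x) = o(|x|^(\<beta> - N))\<close>.  In case (iv) put
  \<open>b = min \<beta> a\<close>, where \<open>b = a\<close> is admissible because \<open>w\<close> belongs to the weighted space with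
  exponent \<open>a\<close>; the absorption \<open>\<mu>(y\<^sub>0) \<ge> const * R^(-\<alpha>)\<close> gives \<open>w(x) = o(|x|^(\<alpha> + b - a))\<close>, and
  \<open>\<alpha> + b \<le> a\<close>.  In all cases \<open>w\<close> vanishes at infinity.  If \<open>w\<close> were not identically zero it would
  attain a positive maximum, where the singular integral is nonnegative and \<open>\<mu> w > 0\<close>, contradicting
  the subsolution inequality (\<open>subsolution_maximum_principle\<close>).
\<close>

section \<open>Radial integrals\<close>

text \<open>Polar coordinates for radial functions: the image of Lebesgue measure under the norm has
  density \<open>N V t^(N - 1)\<close>, \<open>V\<close> being the volume of the unit ball, because both measures give the mass of a ball to every interval \<open>{..r}\<close>.\<close>
lemma distr_norm_lborel:
  "distr (lborel :: 'a::euclidean_space measure) borel norm =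
     density lborel (\<lambda>t. ennreal (DIM('a) * unit_ball_vol DIM('a) * t ^ (DIM('a) - 1)) * indicator {0..} t)"
  (is "?M = ?D")
proof (rule measure_eqI_generator_eq[where E="range atMost" and \<Omega>=UNIV and A="\<lambda>i. {..real i}"])
  show "Int_stable (range (atMost :: real \<Rightarrow> _))"
    by (auto simp: Int_stable_def)
  show "sets ?M = sigma_sets UNIV (range atMost)"
    by (simp add: borel_eq_atMost)
  show "sets ?D = sigma_sets UNIV (range atMost)"
    by (simp add: borel_eq_atMost)
  show "(\<Union>i. {..real i}) = UNIV"
    by (auto intro: real_arch_simple)
  have M: "emeasure ?M {..r} = emeasure lborel (cball (0::'a) r)" for r
    by (subst emeasure_distr) (auto simp: cball_def dist_norm vimage_def)
  show "emeasure ?M {..real i} \<noteq> \<infinity>" for i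
    unfolding M by (simp add: emeasure_cball)
  show "emeasure ?M X = emeasure ?D X" if "X \<in> range atMost" for X
  proof -
    from that obtain r where X: "X = {..r}" by auto
    define n where "n = DIM('a)"
    have n: "n > 0" by (simp add: n_def)
    have D: "emeasure ?D {..r} = (\<integral>\<^sup>+t. ennreal (n * unit_ball_vol n * t ^ (n - 1)) * indicator {0..r} t \<partial>lborel)"
      by (subst emeasure_density)
         (auto simp: n_def mult.assoc intro!: nn_integral_cong split: split_indicator)
    show ?thesis
    proof (cases "r \<ge> 0")
      case True
      have "(\<integral>\<^sup>+t. ennreal (n * unit_ball_vol n * t ^ (n - 1)) * indicator {0..r} t \<partial>lborel)
          = ennreal (unit_ball_vol n * r ^ n - unit_ball_vol n * 0 ^ n)"
        using True n by (intro nn_integral_FTC_Icc[where F="\<lambda>t. unit_ball_vol n * t ^ n"])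
           (auto intro!: derivative_eq_intros)
      then show ?thesis
        unfolding X M D using True n by (simp add: emeasure_cball n_def zero_power)
    next
      case False
      then show ?thesis unfolding X M D by simp
    qed
  qed
qed auto

lemma nn_integral_radial:
  fixes f :: "real \<Rightarrow> ennreal"
  assumes [measurable]: "f \<in> borel_measurable borel"
  shows "(\<integral>\<^sup>+(x::'a::euclidean_space). f (norm x) \<partial>lborel) =
     (\<integral>\<^sup>+t. ennreal (DIM('a) * unit_ball_vol DIM('a) * t ^ (DIM('a) - 1)) * indicator {0..} t * f t \<partial>lborel)"
proof -
  have "(\<integral>\<^sup>+(x::'a). f (norm x) \<partial>lborel) = (\<integral>\<^sup>+t. f t \<partial>distr (lborel :: 'a measure) borel norm)"
    by (subst nn_integral_distr) auto
  also have "\<dots> = (\<integral>\<^sup>+t. ennreal (DIM('a) * unit_ball_vol DIM('a) * t ^ (DIM('a) - 1)) * indicator {0..} t * f t \<partial>lborel)"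
    unfolding distr_norm_lborel by (subst nn_integral_density) auto
  finally show ?thesis .
qed

lemma powr_dim_shift:
  fixes t :: real assumes "t > 0" "n > 0"
  shows "t ^ (n - 1) * t powr (q - real n) = t powr (q - 1)"
proof -
  have "t ^ (n - 1) = t powr (real n - 1)"
    using assms by (simp add: powr_realpow[symmetric] of_nat_diff)
  then show ?thesis by (simp add: powr_add[symmetric])
qed

lemma nn_integral_norm_powr_outside:
  fixes r q :: real
  assumes "0 < r" "0 < q"
  shows "(\<integral>\<^sup>+(x::'a::euclidean_space). ennreal (indicator {x. r < norm x} x * norm x powr (- q - DIM('a))) \<partial>lborel)
     = ennreal (DIM('a) * unit_ball_vol DIM('a) / q * r powr (- q))"
proof -
  define n where "n = DIM('a)"
  have n: "n > 0" by (simp add: n_def)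
  define V where "V = n * unit_ball_vol n"
  have V: "V > 0" using n by (simp add: V_def)
  have "(\<integral>\<^sup>+(x::'a). ennreal (indicator {x. r < norm x} x * norm x powr (- q - DIM('a))) \<partial>lborel)
     = (\<integral>\<^sup>+(x::'a). ennreal (indicator {r<..} (norm x) * norm x powr (- q - n)) \<partial>lborel)"
    by (intro nn_integral_cong) (auto simp: n_def split: split_indicator)
  also have "\<dots> = (\<integral>\<^sup>+t. ennreal (V * t ^ (n - 1)) * indicator {0..} t * ennreal (indicator {r<..} t * t powr (- q - n)) \<partial>lborel)"
    by (subst nn_integral_radial) (auto simp: V_def n_def)
  also have "\<dots> = (\<integral>\<^sup>+t. ennreal (V * t powr (- q - 1)) * indicator {r..} t \<partial>lborel)"
  proof (rule nn_integral_cong_AE)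
    have "AE t in lborel. t \<noteq> r" by (rule AE_lborel_singleton)
    then show "AE t in lborel. ennreal (V * t ^ (n - 1)) * indicator {0..} t * ennreal (indicator {r<..} t * t powr (- q - n))
        = ennreal (V * t powr (- q - 1)) * indicator {r..} t"
    proof eventually_elim
      case (elim t)
      show ?case
      proof (cases "t > r")
        case True
        then show ?thesis
          using assms V powr_dim_shift[of t n "- q"] n
          by (simp add: ennreal_mult[symmetric] mult.assoc)
      qed (use elim in auto)
    qed
  qed
  also have "\<dots> = ennreal (0 - - (V / q * r powr (- q)))"
  proof (rule nn_integral_FTC_atLeast)
    show "((\<lambda>t. - (V / q * t powr (- q))) \<longlongrightarrow> 0) at_top"
      using tendsto_mult_right_zero[OF tendsto_neg_powr[of "-q" "\<lambda>t. t" at_top], of "- (V / q)"] assms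
      by (simp add: filterlim_ident)
    show "((\<lambda>t. - (V / q * t powr (- q))) has_real_derivative V * x powr (- q - 1)) (at x)" if "r \<le> x" for x
      using assms that by (auto intro!: derivative_eq_intros)
  qed (use assms V in auto)
  finally show ?thesis by (simp add: V_def n_def)
qed

lemma nn_integral_norm_powr_annulus:
  fixes e r q :: real
  assumes "0 < e" "e \<le> r" "0 < q"
  shows "(\<integral>\<^sup>+(x::'a::euclidean_space). ennreal (indicator {x. e < norm x \<and> norm x \<le> r} x * norm x powr (q - DIM('a))) \<partial>lborel)
     \<le> ennreal (DIM('a) * unit_ball_vol DIM('a) / q * r powr q)"
proof -
  define n where "n = DIM('a)"
  have n: "n > 0" by (simp add: n_def)
  define V where "V = n * unit_ball_vol n"
  have V: "V > 0" using n by (simp add: V_def)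
  have "(\<integral>\<^sup>+(x::'a). ennreal (indicator {x. e < norm x \<and> norm x \<le> r} x * norm x powr (q - DIM('a))) \<partial>lborel)
     = (\<integral>\<^sup>+(x::'a). ennreal (indicator {e<..r} (norm x) * norm x powr (q - n)) \<partial>lborel)"
    by (intro nn_integral_cong) (auto simp: n_def split: split_indicator)
  also have "\<dots> = (\<integral>\<^sup>+t. ennreal (V * t ^ (n - 1)) * indicator {0..} t * ennreal (indicator {e<..r} t * t powr (q - n)) \<partial>lborel)"
    by (subst nn_integral_radial) (auto simp: V_def n_def)
  also have "\<dots> \<le> (\<integral>\<^sup>+t. ennreal (V * t powr (q - 1)) * indicator {e..r} t \<partial>lborel)"
  proof (rule nn_integral_mono)
    fix t :: real
    show "ennreal (V * t ^ (n - 1)) * indicator {0..} t * ennreal (indicator {e<..r} t * t powr (q - n))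
        \<le> ennreal (V * t powr (q - 1)) * indicator {e..r} t"
    proof (cases "t \<in> {e<..r}")
      case True
      then show ?thesis
        using assms V powr_dim_shift[of t n "q"] n
        by (simp add: ennreal_mult[symmetric] mult.assoc)
    qed auto
  qed
  also have "\<dots> = ennreal (V / q * r powr q - V / q * e powr q)"
    using assms V
    by (intro nn_integral_FTC_Icc[where F="\<lambda>t. V / q * t powr q"]) (auto intro!: derivative_eq_intros)
  also have "\<dots> \<le> ennreal (V / q * r powr q)"
    using V assms by (intro ennreal_leI) auto
  finally show ?thesis by (simp add: V_def n_def)
qed

section \<open>Inequalities for powers\<close>

text \<open>The graph of \<open>|t|^p\<close> lies above its tangent at \<open>a\<close>.  For \<open>a = 0\<close> the slope is \<open>0\<close>,
  whatever the value of \<open>0 powr (p - 1)\<close>, because \<open>sgn 0 = 0\<close>.\<close>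
lemma abs_powr_tangent:
  fixes a b p :: real assumes p: "1 \<le> p"
  shows "\<bar>a\<bar> powr p - \<bar>b\<bar> powr p \<le> p * \<bar>a\<bar> powr (p - 1) * sgn a * (a - b)"
proof (cases "a = 0 \<or> p = 1")
  case True
  then show ?thesis using p by (auto simp: sgn_if powr_def)
next
  case False
  define x y where "x = \<bar>a\<bar>" and "y = \<bar>b\<bar>"
  have x: "x > 0" and y: "y \<ge> 0" and p1: "p > 1" using False p by (auto simp: x_def y_def)
  have key: "x powr p - y powr p \<le> p * x powr (p - 1) * (x - y)"
  proof -
    have "(y * x powr (p - 1)) \<le> y powr p / p + (x powr (p - 1)) powr (p / (p - 1)) / (p / (p - 1))"
      by (rule Youngs_inequality) (use p1 x y in \<open>auto simp: field_simps\<close>)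
    also have "(x powr (p - 1)) powr (p / (p - 1)) = x powr p"
      using p1 by (simp add: powr_powr)
    finally have "p * (y * x powr (p - 1)) \<le> y powr p + (p - 1) * x powr p"
      using p1 by (simp add: field_simps)
    moreover have "x powr (p - 1) * x = x powr p"
      using x by (simp add: powr_mult_base powr_add[symmetric] powr_diff)
    ultimately show ?thesis by (simp add: algebra_simps)
  qed
  have "x - y \<le> sgn a * (a - b)"
    using x by (auto simp: x_def y_def sgn_if abs_if)
  then have "p * x powr (p - 1) * (x - y) \<le> p * x powr (p - 1) * (sgn a * (a - b))"
    using p x by (intro mult_left_mono) auto
  with key show ?thesis by (simp add: x_def y_def mult.assoc)
qed

text \<open>A second-order upper bound for \<open>(1 + v)^(-a)\<close>, derived from Bernoulli's inequality, which is
  the preceding tangent inequality at the point \<open>1\<close>.\<close>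
lemma powr_neg_quadratic_bound:
  fixes a v :: real assumes a: "1 \<le> a" and v: "a * \<bar>v\<bar> \<le> 1/2"
  shows "(1 + v) powr (- a) \<le> 1 - a * v + 2 * a\<^sup>2 * v\<^sup>2"
proof -
  have "\<bar>v\<bar> \<le> a * \<bar>v\<bar>" using mult_right_mono[OF a, of "\<bar>v\<bar>"] by simp
  then have v1: "\<bar>v\<bar> \<le> 1/2" using v by linarith
  have av: "\<bar>a * v\<bar> \<le> 1/2" using a v by (simp add: abs_mult)
  have "1 + a * v \<le> (1 + v) powr a"
    using abs_powr_tangent[OF a, of 1 "1 + v"] v1 by simp
  then have "(1 + v) powr (- a) \<le> 1 / (1 + a * v)"
    using av v1 by (auto simp: powr_minus inverse_eq_divide intro!: divide_left_mono mult_pos_pos)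
  also have "1 / (1 + a * v) \<le> 1 - a * v + 2 * (a * v)\<^sup>2"
  proof -
    define t where "t = a * v"
    have t: "\<bar>t\<bar> \<le> 1/2" using av by (simp add: t_def)
    have "(1 - t + 2 * t\<^sup>2) * (1 + t) = 1 + t\<^sup>2 * (1 + 2 * t)"
      by (simp add: power2_eq_square algebra_simps)
    moreover have "0 \<le> t\<^sup>2 * (1 + 2 * t)" using t by auto
    ultimately have "1 / (1 + t) \<le> 1 - t + 2 * t\<^sup>2" using t by (simp add: field_simps)
    then show ?thesis by (simp add: t_def)
  qed
  finally show ?thesis by (simp add: power_mult_distrib)
qed

section \<open>The truncated singular integral\<close>

text \<open>The integral under the principal value, without the normalising constant, restricted to
  \<open>\<epsilon> < |x - y|\<close> and written in the variable \<open>z = y - x\<close>.\<close>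
definition trunc_lap :: "real \<Rightarrow> (real^'n \<Rightarrow> real) \<Rightarrow> real \<Rightarrow> real^'n \<Rightarrow> real" where
  "trunc_lap s v \<epsilon> x =
     (LINT z|lborel. indicator {z. \<epsilon> < norm z} z * ((v x - v (x + z)) * norm z powr (- (real CARD('n) + 2 * s))))"

text \<open>\<open>w\<close> satisfies \<open>PV \<integral> (w x - w y) |x - y|^(-N - 2 s) dy + \<mu> x * w x \<le> 0\<close> at every point, where the
  principal value is understood as an upper limit of the truncated integrals; the limit itself need
  not exist.\<close>
definition subsolution :: "real \<Rightarrow> (real^'n \<Rightarrow> real) \<Rightarrow> (real^'n \<Rightarrow> real) \<Rightarrow> bool" where
  "subsolution s \<mu> w \<longleftrightarrow>
     (\<forall>x. \<forall>\<delta>>0. \<forall>\<^sub>F \<epsilon> in at_right 0. trunc_lap s w \<epsilon> x \<le> \<delta> - \<mu> x * w x)"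

lemma integral_lborel_shift:
  fixes f :: "'a::euclidean_space \<Rightarrow> real"
  assumes [measurable]: "f \<in> borel_measurable borel"
  shows "(LINT y|lborel. f y) = (LINT z|lborel. f (x + z))"
proof -
  have "(LINT y|lborel. f y) = (LINT y|distr lborel borel ((+) x). f y)"
    by (simp add: lborel_distr_plus)
  also have "\<dots> = (LINT z|lborel. f (x + z))"
    by (subst integral_distr) auto
  finally show ?thesis .
qed

lemma integrable_lborel_shift:
  fixes f :: "'a::euclidean_space \<Rightarrow> real"
  assumes "integrable lborel f"
  shows "integrable lborel (\<lambda>z. f (x + z))"
proof -
  have "integrable (distr lborel borel ((+) x)) f"
    using assms by (simp add: lborel_distr_plus)
  then show ?thesis
    by (rule integrable_distr[rotated]) auto
qed

lemma integral_lborel_uminus: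
  fixes f :: "'a::euclidean_space \<Rightarrow> real"
  assumes [measurable]: "f \<in> borel_measurable borel"
  shows "(LINT z|lborel. f (- z)) = (LINT z|lborel. f z)"
proof -
  have "lborel = distr lborel borel (\<lambda>z::'a. - z)"
    using lborel_affine[of "-1" "0::'a"] by (simp add: density_1)
  then have "(LINT z|lborel. f z) = (LINT z|distr lborel borel (\<lambda>z::'a. - z). f z)"
    by simp
  also have "\<dots> = (LINT z|lborel. f (- z))"
    by (subst integral_distr) auto
  finally show ?thesis by simp
qed

lemma LINT_eq_trunc_lap:
  fixes v :: "real^'n \<Rightarrow> real"
  assumes [measurable]: "v \<in> borel_measurable borel"
  shows "(LINT y:{y. \<epsilon> < dist x y}|lebesgue. (v x - v y) / norm (x - y) powr (real CARD('n) + 2 * s))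
     = trunc_lap s v \<epsilon> x"
proof -
  let ?f = "\<lambda>y. indicator {y. \<epsilon> < dist x y} y *\<^sub>R ((v x - v y) / norm (x - y) powr (real CARD('n) + 2 * s))"
  have "(LINT y:{y. \<epsilon> < dist x y}|lebesgue. (v x - v y) / norm (x - y) powr (real CARD('n) + 2 * s))
      = (LINT y|lborel. ?f y)"
    unfolding set_lebesgue_integral_def by (rule integral_completion) measurable
  also have "\<dots> = (LINT z|lborel. ?f (x + z))"
    by (rule integral_lborel_shift) measurable
  also have "\<dots> = trunc_lap s v \<epsilon> x"
    unfolding trunc_lap_def powr_minus_divide
    by (intro Bochner_Integration.integral_cong) (auto simp: dist_norm split: split_indicator)
  finally show ?thesis .
qed

lemma norm_powr_tail:
  fixes r s :: real
  assumes "0 < r" "0 < s"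
  shows integrable_norm_powr_tail:
      "integrable lborel (\<lambda>z::real^'n. indicator {z. r < norm z} z * norm z powr (- (real CARD('n) + 2 * s)))"
    and integral_norm_powr_tail:
      "(LINT z|lborel. indicator {z::real^'n. r < norm z} z * norm z powr (- (real CARD('n) + 2 * s)))
        = CARD('n) * unit_ball_vol CARD('n) / (2 * s) * r powr (- 2 * s)"
proof -
  let ?f = "\<lambda>z::real^'n. indicator {z. r < norm z} z * norm z powr (- (real CARD('n) + 2 * s))"
  let ?c = "CARD('n) * unit_ball_vol CARD('n) / (2 * s) * r powr (- 2 * s)"
  have exponent: "- (real CARD('n) + 2 * s) = - (2 * s) - real CARD('n)" by simp
  have "(\<integral>\<^sup>+ z. ennreal (?f z) \<partial>lborel) = ennreal ?c"
    unfolding exponent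
    using nn_integral_norm_powr_outside[of r "2 * s", where 'a="real^'n"] assms by simp
  then have "integrable lborel ?f \<and> integral\<^sup>L lborel ?f = ?c"
    using assms by (subst (asm) nn_integral_eq_integrable) auto
  then show "integrable lborel ?f" "integral\<^sup>L lborel ?f = ?c" by auto
qed

lemma integrable_norm_powr_annulus:
  fixes e r s q :: real
  assumes "0 < e" "0 < s"
  shows "integrable lborel (\<lambda>z::real^'n. indicator {z. e < norm z \<and> norm z \<le> r} z * norm z powr q)"
proof -
  define a where "a = real CARD('n) + 2 * s"
  have [measurable]: "{z::real^'n. e < norm z \<and> norm z \<le> r} \<in> sets borel" by measurable
  show ?thesis
  proof (rule Bochner_Integration.integrable_bound)
    show "integrable lborel (\<lambda>z::real^'n. (e powr (q + a) + r powr (q + a)) * (indicator {z. e < norm z} z * norm z powr (- a)))"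
      unfolding a_def by (intro integrable_mult_right integrable_norm_powr_tail assms)
    show "AE z in lborel. norm (indicator {z::real^'n. e < norm z \<and> norm z \<le> r} z * norm z powr q)
       \<le> norm ((e powr (q + a) + r powr (q + a)) * (indicator {z. e < norm z} z * norm z powr (- a)))"
    proof (rule AE_I2)
      fix z :: "real^'n"
      show "norm (indicator {z::real^'n. e < norm z \<and> norm z \<le> r} z * norm z powr q)
       \<le> norm ((e powr (q + a) + r powr (q + a)) * (indicator {z. e < norm z} z * norm z powr (- a)))"
      proof (cases "e < norm z \<and> norm z \<le> r")
        case True
        have "norm z powr (q + a) \<le> e powr (q + a) + r powr (q + a)"
        proof (cases "q + a \<ge> 0")
          case T: True
          then have "norm z powr (q + a) \<le> r powr (q + a)" using True by (intro powr_mono2) auto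
          then show ?thesis by (simp add: add_increasing)
        next
          case F: False
          then have "norm z powr (q + a) \<le> e powr (q + a)"
            using True assms by (intro powr_mono2') auto
          then show ?thesis by (simp add: add_increasing2)
        qed
        then have "norm z powr (q + a) * norm z powr (- a) \<le> (e powr (q + a) + r powr (q + a)) * norm z powr (- a)"
          by (rule mult_right_mono) simp
        then show ?thesis using True by (simp add: powr_add[symmetric])
      qed auto
    qed
  qed measurable
qed

lemma integral_norm_powr_annulus_le:
  fixes e r s :: real
  assumes "0 < e" "e \<le> r" "0 < s" "s < 1"
  shows "(LINT z|lborel. indicator {z::real^'n. e < norm z \<and> norm z \<le> r} z * norm z powr (2 - (real CARD('n) + 2 * s)))
    \<le> CARD('n) * unit_ball_vol CARD('n) / (2 - 2 * s) * r powr (2 - 2 * s)"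
proof -
  let ?f = "\<lambda>z::real^'n. indicator {z. e < norm z \<and> norm z \<le> r} z * norm z powr (2 - (real CARD('n) + 2 * s))"
  let ?c = "CARD('n) * unit_ball_vol CARD('n) / (2 - 2 * s) * r powr (2 - 2 * s)"
  have exponent: "2 - (real CARD('n) + 2 * s) = 2 - 2 * s - real CARD('n)" by simp
  have "(\<integral>\<^sup>+ z. ennreal (?f z) \<partial>lborel) \<le> ennreal ?c"
    unfolding exponent
    using nn_integral_norm_powr_annulus[of e r "2 - 2 * s", where 'a="real^'n"] assms by simp
  moreover have "(\<integral>\<^sup>+ z. ennreal (?f z) \<partial>lborel) = ennreal (integral\<^sup>L lborel ?f)"
    using assms by (intro nn_integral_eq_integral integrable_norm_powr_annulus) auto
  ultimately show ?thesis
    using assms by (simp add: ennreal_le_iff)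
qed

section \<open>Integrability against the kernel\<close>

lemma weighted_int_mult_integrable:
  fixes v g :: "real^'n \<Rightarrow> real"
  assumes v: "v \<in> weighted_int s" and [measurable]: "v \<in> borel_measurable borel" "g \<in> borel_measurable borel"
    and g: "\<And>y. \<bar>g y\<bar> * (1 + norm y powr (real CARD('n) + 2 * s)) \<le> C"
  shows "integrable lborel (\<lambda>y. v y * g y)"
proof (rule Bochner_Integration.integrable_bound)
  have "integrable lebesgue (\<lambda>x. \<bar>v x\<bar> / (1 + norm x powr (real CARD('n) + 2 * s)))"
    using v by (simp add: weighted_int_def)
  then have "integrable lborel (\<lambda>x. \<bar>v x\<bar> / (1 + norm x powr (real CARD('n) + 2 * s)))"
    by (subst (asm) integrable_completion) auto
  then show "integrable lborel (\<lambda>x. C * (\<bar>v x\<bar> / (1 + norm x powr (real CARD('n) + 2 * s))))"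
    by (rule integrable_mult_right)
  have C: "0 \<le> C" by (rule order_trans[OF _ g[of 0]]) simp
  show "AE y in lborel. norm (v y * g y) \<le> norm (C * (\<bar>v y\<bar> / (1 + norm y powr (real CARD('n) + 2 * s))))"
  proof (rule AE_I2)
    fix y :: "real^'n"
    define D where "D = (1 :: real) + norm y powr (real CARD('n) + 2 * s)"
    have D: "D > 0" unfolding D_def by (simp add: add_pos_nonneg)
    have "\<bar>g y\<bar> \<le> C / D" using g[of y] D by (simp add: D_def[symmetric] pos_le_divide_eq)
    then have "\<bar>v y\<bar> * \<bar>g y\<bar> \<le> \<bar>v y\<bar> * (C / D)" by (rule mult_left_mono) simp
    then show "norm (v y * g y) \<le> norm (C * (\<bar>v y\<bar> / (1 + norm y powr (real CARD('n) + 2 * s))))"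
      unfolding D_def[symmetric] using C D by (simp add: abs_mult mult.commute)
  qed
qed measurable

text \<open>Compares a kernel \<open>b^(-a)\<close> that stays away from its singularity (\<open>b \<ge> r\<close>) with the weight
  \<open>1 + t^a\<close>.  In applications \<open>b\<close> is the distance of a point to \<open>x\<close>, possibly plus a positive constant, \<open>t\<close> is
  the norm of that point, and \<open>n\<close> is the norm of \<open>x\<close>.\<close>
lemma one_plus_powr_le:
  fixes a b r t n :: real
  assumes "0 \<le> a" "0 < r" "r \<le> b" "0 \<le> t" "0 \<le> n" "t \<le> n + b"
  shows "b powr (- a) * (1 + t powr a) \<le> 2 * (1 / r + 1 + n / r) powr a"
proof -
  define A where "A = 1 / r + 1 + n / r"
  have A: "0 \<le> A" using assms by (simp add: A_def)
  have Ab: "A * b = b / r + b + n * (b / r)" by (simp add: A_def algebra_simps)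
  have br: "1 \<le> b / r" using assms by simp
  have "n * 1 \<le> n * (b / r)" by (rule mult_left_mono[OF br]) (use assms in auto)
  then have t: "t \<le> A * b" and one: "1 \<le> A * b" unfolding Ab using br assms by linarith+
  have "t powr a \<le> (A * b) powr a" using assms t by (intro powr_mono2) auto
  moreover have "1 \<le> (A * b) powr a" using assms one by (intro ge_one_powr_ge_zero) auto
  ultimately have "b powr (- a) * (1 + t powr a) \<le> b powr (- a) * (2 * (A * b) powr a)"
    by (intro mult_left_mono) auto
  also have "\<dots> = 2 * A powr a" using assms A by (simp add: powr_mult powr_minus)
  finally show ?thesis by (simp add: A_def)
qed

lemma integrable_shift_tail:
  fixes v :: "real^'n \<Rightarrow> real"
  assumes v: "v \<in> weighted_int s" and [measurable]: "v \<in> borel_measurable borel" and r: "0 < r" and s: "0 < s"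
  shows "integrable lborel (\<lambda>z. indicator {z. r < norm z} z * (v (x + z) * norm z powr (- (real CARD('n) + 2 * s))))"
proof -
  define a where "a = real CARD('n) + 2 * s"
  have a: "a \<ge> 0" using s by (simp add: a_def)
  define A where "A = 1 / r + 1 + norm x / r"
  let ?g = "\<lambda>y. indicator {y. r < norm (y - x)} y * norm (y - x) powr (- a)"
  have "integrable lborel (\<lambda>y. v y * ?g y)"
  proof (rule weighted_int_mult_integrable[OF v, where C="2 * A powr a"])
    fix y :: "real^'n"
    show "\<bar>?g y\<bar> * (1 + norm y powr (real CARD('n) + 2 * s)) \<le> 2 * A powr a"
    proof (cases "r < norm (y - x)")
      case True
      have "norm y \<le> norm x + norm (y - x)" using norm_triangle_ineq[of x "y - x"] by simp
      then have "norm (y - x) powr (- a) * (1 + norm y powr a) \<le> 2 * A powr a"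
        unfolding A_def using True a r by (intro one_plus_powr_le) auto
      then show ?thesis using True by (simp add: a_def)
    next
      case False
      then show ?thesis by simp
    qed
  qed measurable
  from integrable_lborel_shift[OF this, of x] show ?thesis
    by (rule Bochner_Integration.integrable_cong[THEN iffD1, rotated -1])
       (auto simp: a_def split: split_indicator)
qed

lemma trunc_lap_integrable:
  fixes v :: "real^'n \<Rightarrow> real"
  assumes v: "v \<in> weighted_int s" and m: "v \<in> borel_measurable borel" and r: "0 < r" and s: "0 < s"
  shows "integrable lborel (\<lambda>z. indicator {z. r < norm z} z * ((v x - v (x + z)) * norm z powr (- (real CARD('n) + 2 * s))))"
  using Bochner_Integration.integrable_diff[OF integrable_mult_right[OF integrable_norm_powr_tail[OF r s], of "v x"]
      integrable_shift_tail[OF v m r s, of x]]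
  by (simp add: algebra_simps)

section \<open>The local bound for subsolutions\<close>

text \<open>If \<open>w\<close> lies below a paraboloid that touches it at \<open>y\<close>, the truncated integral at \<open>y\<close> is bounded
  below uniformly in the truncation.  Over the annulus \<open>e < |z| \<le> r\<close> the linear term \<open>l \<bullet> z\<close>
  integrates to zero by oddness and the quadratic term gives \<open>r^(2 - 2 s)\<close>; outside the ball of
  radius \<open>r\<close> the two terms of \<open>w y - w (y + z)\<close> are integrated separately.\<close>
lemma trunc_lap_touching:
  fixes w :: "real^'n \<Rightarrow> real"
  assumes w: "w \<in> weighted_int s" and m[measurable]: "w \<in> borel_measurable borel"
    and s: "0 < s" "s < 1" and e: "0 < e" "e \<le> r" and B: "0 \<le> B" and wy: "0 \<le> w y"
    and touch: "\<And>z. norm z \<le> r \<Longrightarrow> w (y + z) \<le> w y * (1 + l \<bullet> z + B * (norm z)\<^sup>2)"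
  defines "V \<equiv> real CARD('n) * unit_ball_vol CARD('n)"
  shows "w y * (V / (2 * s) * r powr (- 2 * s) - B * (V / (2 - 2 * s) * r powr (2 - 2 * s)))
      - (LINT z|lborel. indicator {z. r < norm z} z * (w (y + z) * norm z powr (- (real CARD('n) + 2 * s))))
    \<le> trunc_lap s w e y"
proof -
  define a where "a = real CARD('n) + 2 * s"
  have r: "0 < r" using e by simp
  define T where "T = (\<lambda>z::real^'n. indicator {z. r < norm z} z * norm z powr (- a))"
  define W where "W = (\<lambda>z. indicator {z. r < norm z} z * (w (y + z) * norm z powr (- a)))"
  define A where "A = (\<lambda>z::real^'n. indicator {z. e < norm z \<and> norm z \<le> r} z * norm z powr (2 - a))"
  define O' where "O' = (\<lambda>z::real^'n. indicator {z. e < norm z \<and> norm z \<le> r} z * ((l \<bullet> z) * norm z powr (- a)))"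
  define F where "F = (\<lambda>z. indicator {z. e < norm z} z * ((w y - w (y + z)) * norm z powr (- a)))"
  have T: "integrable lborel T" "integral\<^sup>L lborel T = V / (2 * s) * r powr (- 2 * s)"
    unfolding T_def a_def V_def
    by (rule integrable_norm_powr_tail[OF r s(1)], rule integral_norm_powr_tail[OF r s(1)])
  have W: "integrable lborel W"
    unfolding W_def a_def by (rule integrable_shift_tail[OF w m r s(1)])
  have A: "integrable lborel A" "integral\<^sup>L lborel A \<le> V / (2 - 2 * s) * r powr (2 - 2 * s)"
    unfolding A_def a_def V_def
    by (rule integrable_norm_powr_annulus[OF e(1) s(1)], rule integral_norm_powr_annulus_le[OF e s])
  have F: "integrable lborel F"
    unfolding F_def a_def by (rule trunc_lap_integrable[OF w m e(1) s(1)])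
  have O: "integrable lborel O'"
  proof (rule Bochner_Integration.integrable_bound)
    show "integrable lborel (\<lambda>z::real^'n. norm l * (indicator {z. e < norm z \<and> norm z \<le> r} z * norm z powr (1 - a)))"
      by (intro integrable_mult_right integrable_norm_powr_annulus[OF e(1) s(1)])
    show "AE z in lborel. norm (O' z) \<le> norm (norm l * (indicator {z. e < norm z \<and> norm z \<le> r} z * norm z powr (1 - a)))"
    proof (rule AE_I2)
      fix z :: "real^'n"
      show "norm (O' z) \<le> norm (norm l * (indicator {z. e < norm z \<and> norm z \<le> r} z * norm z powr (1 - a)))"
      proof (cases "e < norm z \<and> norm z \<le> r")
        case True
        have "\<bar>l \<bullet> z\<bar> * norm z powr (- a) \<le> norm l * norm z * norm z powr (- a)"
          by (intro mult_right_mono Cauchy_Schwarz_ineq2) auto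
        also have "\<dots> = norm l * norm z powr (1 - a)"
          using True e by (simp add: powr_diff powr_minus_divide)
        finally show ?thesis using True by (simp add: O'_def abs_mult)
      qed (auto simp: O'_def)
    qed
    show "O' \<in> borel_measurable lborel" unfolding O'_def by measurable
  qed
  have "integral\<^sup>L lborel O' = 0"
  proof -
    have mO: "O' \<in> borel_measurable borel" unfolding O'_def by measurable
    have "integral\<^sup>L lborel O' = (LINT z|lborel. O' (- z))"
      by (rule integral_lborel_uminus[OF mO, symmetric])
    also have "\<dots> = (LINT z|lborel. - O' z)"
      by (intro Bochner_Integration.integral_cong) (auto simp: O'_def split: split_indicator)
    finally show ?thesis by simp
  qed
  then have "w y * (integral\<^sup>L lborel T - B * integral\<^sup>L lborel A) - integral\<^sup>L lborel W
     = (LINT z|lborel. w y * (T z - O' z - B * A z) - W z)"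
    using T A W O by (simp add: algebra_simps)
  also have "\<dots> \<le> integral\<^sup>L lborel F"
  proof (rule integral_mono)
    show "integrable lborel (\<lambda>z. w y * (T z - O' z - B * A z) - W z)"
      using T A W O by (intro Bochner_Integration.integrable_diff integrable_mult_right) auto
    show "integrable lborel F" by (rule F)
    fix z :: "real^'n"
    consider "norm z \<le> e" | "e < norm z" "norm z \<le> r" | "r < norm z" by linarith
    then show "w y * (T z - O' z - B * A z) - W z \<le> F z"
    proof cases
      case 1
      then show ?thesis using e by (simp add: T_def O'_def A_def W_def F_def)
    next
      case 2
      have "norm z powr (2 - a) = (norm z)\<^sup>2 * norm z powr (- a)"
        using 2 e by (simp add: powr_diff powr_minus_divide powr_numeral)
      then have "w y * (T z - O' z - B * A z) - W z = (w y - w y * (1 + l \<bullet> z + B * (norm z)\<^sup>2)) * norm z powr (- a)"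
        using 2 by (simp add: T_def O'_def A_def W_def algebra_simps)
      also have "\<dots> \<le> (w y - w (y + z)) * norm z powr (- a)"
        using touch[OF 2(2)] by (intro mult_right_mono) auto
      also have "\<dots> = F z" using 2 by (simp add: F_def)
      finally show ?thesis .
    next
      case 3
      then show ?thesis using e by (simp add: T_def O'_def A_def W_def F_def algebra_simps)
    qed
  qed
  also have "\<dots> = trunc_lap s w e y"
    by (simp add: trunc_lap_def F_def a_def)
  finally have main: "w y * (integral\<^sup>L lborel T - B * integral\<^sup>L lborel A) - integral\<^sup>L lborel W \<le> trunc_lap s w e y" .
  have "w y * (integral\<^sup>L lborel T - B * (V / (2 - 2 * s) * r powr (2 - 2 * s))) \<le> w y * (integral\<^sup>L lborel T - B * integral\<^sup>L lborel A)"
    using A(2) B wy by (intro mult_left_mono diff_left_mono) auto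
  with main show ?thesis unfolding T(2) by (simp add: W_def a_def)
qed

text \<open>The estimate is uniform in the subsolution, the coefficient, the centre and the radius.  The
  point \<open>y\<close> is where \<open>w q^a\<close> is maximal, with \<open>q = 1 - |x - y|\<^sup>2 / R\<^sup>2\<close>.\<close>
lemma subsolution_local_bound:
  fixes s :: real
  assumes s: "0 < s" "s < 1"
  shows "\<exists>C>0. \<forall>(w :: real^'n \<Rightarrow> real) \<mu> x R. 0 < R \<longrightarrow> continuous_on UNIV w \<longrightarrow> w \<in> weighted_int s \<longrightarrow>
    (\<forall>y. 0 \<le> w y) \<longrightarrow> (\<forall>y. 0 \<le> \<mu> y) \<longrightarrow> subsolution s \<mu> w \<longrightarrow>
    (\<exists>y\<in>ball x R. (\<mu> y + R powr (- 2 * s)) * w x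
        \<le> C * (LINT y|lborel. w y * (R + dist x y) powr (- (real CARD('n) + 2 * s))))"
proof -
  define a where "a = real CARD('n) + 2 * s"
  have "CARD('n) \<ge> 1" using zero_less_card_finite[where 'a='n] by linarith
  then have "real CARD('n) \<ge> 1" by simp
  then have a: "1 \<le> a" "0 < a" unfolding a_def using s by linarith+
  define V where "V = real CARD('n) * unit_ball_vol CARD('n)"
  have V: "V > 0" by (simp add: V_def)
  \<comment> \<open>\<open>\<kappa> r^(-2 s)\<close> is the mass of the kernel outside the ball of radius \<open>r\<close>, and \<open>\<nu> r^(2 - 2 s)\<close>
    bounds its second moment inside.\<close>
  define \<kappa> where "\<kappa> = V / (2 * s)"
  define \<nu> where "\<nu> = V / (2 - 2 * s)"
  have \<kappa>: "\<kappa> > 0" and \<nu>: "\<nu> > 0" using V s by (auto simp: \<kappa>_def \<nu>_def)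
  \<comment> \<open>The first bound on \<open>\<theta>\<close> keeps the relative change of \<open>q\<close> within the range of the second-order
    expansion; the second one makes the near part at most half of the far part.\<close>
  define \<theta> where "\<theta> = min (1 / (6 * a)) (sqrt (\<kappa> / (38 * a\<^sup>2 * \<nu>)))"
  have \<theta>: "0 < \<theta>" "6 * a * \<theta> \<le> 1" "\<theta> \<le> 1"
  proof -
    show "0 < \<theta>" using a \<kappa> \<nu> by (simp add: \<theta>_def)
    have "\<theta> \<le> 1 / (6 * a)" by (simp add: \<theta>_def)
    then show "6 * a * \<theta> \<le> 1" using a by (simp add: field_simps)
    moreover have "\<theta> * 1 \<le> \<theta> * (6 * a)" using a \<open>0 < \<theta>\<close> by (intro mult_left_mono) auto
    ultimately show "\<theta> \<le> 1" by (simp add: algebra_simps)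
  qed
  have \<theta>2: "19 * a\<^sup>2 * \<theta>\<^sup>2 * \<nu> \<le> \<kappa> / 2"
  proof -
    have "\<theta>\<^sup>2 \<le> (sqrt (\<kappa> / (38 * a\<^sup>2 * \<nu>)))\<^sup>2"
      using \<theta> by (intro power_mono) (auto simp: \<theta>_def)
    also have "\<dots> = \<kappa> / (38 * a\<^sup>2 * \<nu>)" using a \<kappa> \<nu> by simp
    finally show ?thesis using a \<nu> by (simp add: field_simps)
  qed
  define C where "C = (3 / \<theta>) powr a / min 1 (\<kappa> / 2)"
  have C: "C > 0" using \<theta> \<kappa> by (simp add: C_def)
  have "\<exists>y\<in>ball x R. (\<mu> y + R powr (- 2 * s)) * w x \<le> C * (LINT y|lborel. w y * (R + dist x y) powr (- a))"
    if R: "0 < R" and cont: "continuous_on UNIV w" and w: "w \<in> weighted_int s" and w0: "\<And>y. 0 \<le> w y"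
      and \<mu>: "\<And>y. 0 \<le> \<mu> y" and sub: "subsolution s \<mu> w" for w :: "real^'n \<Rightarrow> real" and \<mu> x R
  proof (cases "w x = 0")
    case True
    have "0 \<le> (LINT y|lborel. w y * (R + dist x y) powr (- a))"
      using w0 by (intro integral_nonneg_AE) auto
    then show ?thesis using True R C by (intro bexI[of _ x]) auto
  next
    case False
    have mw[measurable]: "w \<in> borel_measurable borel"
      using cont by (rule borel_measurable_continuous_onI)
    define q where "q = (\<lambda>y. 1 - (dist x y)\<^sup>2 / R\<^sup>2)"
    have q_nonneg: "0 \<le> q y \<longleftrightarrow> dist x y \<le> R" for y
      using R by (simp add: q_def abs_le_square_iff[symmetric])
    have "\<exists>y\<in>cball x R. \<forall>y'\<in>cball x R. w y' * q y' powr a \<le> w y * q y powr a"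
    proof (rule continuous_attains_sup)
      show "continuous_on (cball x R) (\<lambda>y. w y * q y powr a)"
      proof (intro continuous_on_mult continuous_on_powr' ballI)
        show "continuous_on (cball x R) w" using cont continuous_on_subset by blast
        show "continuous_on (cball x R) q" unfolding q_def using R by (intro continuous_intros) auto
        show "0 \<le> q y \<and> (q y = 0 \<longrightarrow> 0 < a)" if "y \<in> cball x R" for y
          using that a by (simp add: q_nonneg)
      qed auto
    qed (use R in auto)
    then obtain y where y: "dist x y \<le> R"
      and max: "\<And>y'. dist x y' \<le> R \<Longrightarrow> w y' * q y' powr a \<le> w y * q y powr a" by auto
    have qx: "q x = 1" by (simp add: q_def)
    have wx: "w x \<le> w y * q y powr a" using max[of x] R by (simp add: qx)
    moreover have "w x > 0" using w0[of x] False by simp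
    ultimately have "q y \<noteq> 0" using a by auto
    moreover have "0 \<le> q y" using y q_nonneg by blast
    ultimately have "0 < q y" by simp
    moreover have "q y \<le> 1" by (simp add: q_def)
    ultimately have q: "0 < q y" "q y \<le> 1" by blast+
    have dy: "dist x y < R"
    proof (rule ccontr)
      assume "\<not> dist x y < R"
      then have "dist x y = R" using y by simp
      then show False using q R by (simp add: q_def)
    qed
    define r where "r = \<theta> * R * q y"
    have r: "0 < r" "r \<le> \<theta> * R" "r \<le> R"
    proof -
      show "0 < r" using \<theta> R q by (simp add: r_def)
      show "r \<le> \<theta> * R" unfolding r_def using \<theta> R q by (intro mult_left_le) auto
      also have "\<theta> * R \<le> 1 * R" using \<theta> R by (intro mult_right_mono) auto
      finally show "r \<le> R" by simp
    qed
    \<comment> \<open>\<open>19 a\<^sup>2\<close> bounds the sum of the second-order contributions \<open>a\<close>, from \<open>|z|\<^sup>2\<close> in the increment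
      of \<open>q\<close>, and \<open>2 a\<^sup>2 * 3\<^sup>2\<close>, from the square of this increment.\<close>
    define B where "B = 19 * a\<^sup>2 / (R * q y)\<^sup>2"
    define l where "l = (2 * a / (R\<^sup>2 * q y)) *\<^sub>R (y - x)"
    have touch: "w (y + z) \<le> w y * (1 + l \<bullet> z + B * (norm z)\<^sup>2)" if z: "norm z \<le> r" for z
    proof -
      \<comment> \<open>the relative increment of \<open>q\<close>\<close>
      define v where "v = - ((2 * ((y - x) \<bullet> z) + (norm z)\<^sup>2) / (R\<^sup>2 * q y))"
      have dxy: "dist x y = norm (y - x)"
        by (simp add: dist_norm norm_minus_commute)
      have "(dist x (y + z))\<^sup>2 = (norm ((y - x) + z))\<^sup>2"
        by (simp add: dist_norm norm_minus_commute algebra_simps)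
      also have "\<dots> = (dist x y)\<^sup>2 + 2 * ((y - x) \<bullet> z) + (norm z)\<^sup>2"
        unfolding dxy power2_norm_eq_inner
        by (simp add: inner_add_left inner_add_right inner_commute)
      finally have "q (y + z) = q y - (2 * ((y - x) \<bullet> z) + (norm z)\<^sup>2) / R\<^sup>2"
        by (simp add: q_def diff_divide_distrib add_divide_distrib)
      moreover have "q y * v = - ((2 * ((y - x) \<bullet> z) + (norm z)\<^sup>2) / R\<^sup>2)"
        using q R by (simp add: v_def)
      ultimately have qz: "q (y + z) = q y * (1 + v)"
        unfolding distrib_left by linarith
      have "\<bar>(y - x) \<bullet> z\<bar> \<le> R * norm z"
        using order_trans[OF Cauchy_Schwarz_ineq2 mult_right_mono, of "y - x" R z] dy
        by (simp add: dist_norm norm_minus_commute)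
      moreover have "(norm z)\<^sup>2 \<le> R * norm z"
        using z r by (simp add: power2_eq_square mult_right_mono)
      ultimately have "\<bar>2 * ((y - x) \<bullet> z) + (norm z)\<^sup>2\<bar> \<le> 3 * (R * norm z)"
        using zero_le_power2[of "norm z"] by linarith
      then have "\<bar>v\<bar> \<le> 3 * (R * norm z) / (R\<^sup>2 * q y)"
        unfolding v_def using R q by (simp add: abs_minus_cancel divide_right_mono)
      also have "\<dots> = 3 * (norm z / (R * q y))"
        using R q by (simp add: power2_eq_square)
      finally have v: "\<bar>v\<bar> \<le> 3 * (norm z / (R * q y))" .
      have "norm z / (R * q y) \<le> \<theta>"
        using z R q by (simp add: r_def pos_divide_le_eq mult.assoc)
      then have "a * \<bar>v\<bar> \<le> a * (3 * \<theta>)" using v a by (intro mult_left_mono) auto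
      then have av: "a * \<bar>v\<bar> \<le> 1/2" using \<theta> by simp
      have "1 * \<bar>v\<bar> \<le> a * \<bar>v\<bar>" using a by (intro mult_right_mono) auto
      then have v1: "\<bar>v\<bar> \<le> 1/2" using av by simp
      have "0 \<le> q (y + z)" unfolding qz using q v1 by simp
      then have "w (y + z) * q (y + z) powr a \<le> w y * q y powr a"
        using max q_nonneg by blast
      also have "q (y + z) powr a = q y powr a * (1 + v) powr a"
        unfolding qz using q v1 by (intro powr_mult) 
      finally have "(w (y + z) * (1 + v) powr a) * q y powr a \<le> w y * q y powr a"
        by (simp add: ac_simps)
      then have "w (y + z) * (1 + v) powr a \<le> w y"
        using q by (simp add: mult_le_cancel_right)
      then have "w (y + z) \<le> w y * (1 + v) powr (- a)"
        using v1 by (simp add: powr_minus field_simps)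
      also have "\<dots> \<le> w y * (1 - a * v + 2 * a\<^sup>2 * v\<^sup>2)"
        using powr_neg_quadratic_bound[OF a(1) av] w0 by (intro mult_left_mono) auto
      also have "\<dots> \<le> w y * (1 + l \<bullet> z + B * (norm z)\<^sup>2)"
      proof (intro mult_left_mono w0)
        define k where "k = (norm z)\<^sup>2 / (R * q y)\<^sup>2"
        have "v\<^sup>2 \<le> (3 * (norm z / (R * q y)))\<^sup>2"
          using v by (intro abs_le_square_iff[THEN iffD1]) (use R q in auto)
        then have v2: "v\<^sup>2 \<le> 9 * k" by (simp add: k_def power_mult_distrib power_divide)
        have "(norm z)\<^sup>2 / (R\<^sup>2 * q y) = k * q y" using q R by (simp add: k_def power2_eq_square)
        also have "\<dots> \<le> k" using q by (intro mult_left_le) (auto simp: k_def)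
        finally have k1: "(norm z)\<^sup>2 / (R\<^sup>2 * q y) \<le> k" .
        have k0: "0 \<le> k" by (simp add: k_def)
        have "- v = 2 * ((y - x) \<bullet> z) / (R\<^sup>2 * q y) + (norm z)\<^sup>2 / (R\<^sup>2 * q y)"
          by (simp add: v_def add_divide_distrib)
        then have "a * (- v) = a * (2 * ((y - x) \<bullet> z) / (R\<^sup>2 * q y)) + a * ((norm z)\<^sup>2 / (R\<^sup>2 * q y))"
          by (simp only: distrib_left)
        moreover have "a * (2 * ((y - x) \<bullet> z) / (R\<^sup>2 * q y)) = l \<bullet> z"
          unfolding l_def inner_scaleR_left by (simp only: times_divide_eq_left times_divide_eq_right mult_ac)
        ultimately have "- (a * v) = l \<bullet> z + a * ((norm z)\<^sup>2 / (R\<^sup>2 * q y))"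
          by simp
        moreover have "a * ((norm z)\<^sup>2 / (R\<^sup>2 * q y)) \<le> a * k" using k1 a by (intro mult_left_mono) auto
        moreover have "a * k \<le> a\<^sup>2 * k"
          using k0 a by (intro mult_right_mono) (auto simp: power2_eq_square)
        moreover have "2 * a\<^sup>2 * v\<^sup>2 \<le> 2 * a\<^sup>2 * (9 * k)" using v2 by (intro mult_left_mono) auto
        moreover have "B * (norm z)\<^sup>2 = 19 * (a\<^sup>2 * k)" by (simp add: B_def k_def)
        ultimately show "1 - a * v + 2 * a\<^sup>2 * v\<^sup>2 \<le> 1 + l \<bullet> z + B * (norm z)\<^sup>2" by linarith
      qed
      finally show ?thesis .
    qed
    define T where "T = (LINT z|lborel. indicator {z. r < norm z} z * (w (y + z) * norm z powr (- a)))"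
    have "B * (\<nu> * r powr (2 - 2 * s)) \<le> \<kappa> / 2 * r powr (- 2 * s)"
    proof -
      have "r powr (2 - 2 * s) = r\<^sup>2 * r powr (- 2 * s)"
        using r by (simp add: powr_diff powr_minus_divide powr_numeral)
      moreover have r_sq: "r\<^sup>2 = \<theta>\<^sup>2 * (R * q y)\<^sup>2"
        by (simp add: r_def power_mult_distrib)
      ultimately have "B * (\<nu> * r powr (2 - 2 * s)) = (19 * a\<^sup>2 * \<theta>\<^sup>2 * \<nu>) * r powr (- 2 * s)"
        using R q by (simp add: B_def r_sq)
      also have "\<dots> \<le> \<kappa> / 2 * r powr (- 2 * s)" by (rule mult_right_mono[OF \<theta>2]) simp
      finally show ?thesis .
    qed
    then have near: "w y * (\<kappa> / 2 * r powr (- 2 * s)) - T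
        \<le> w y * (\<kappa> * r powr (- 2 * s) - B * (\<nu> * r powr (2 - 2 * s))) - T"
      by (intro diff_right_mono mult_left_mono w0) simp
    have "(\<mu> y + \<kappa> / 2 * r powr (- 2 * s)) * w y \<le> T"
    proof (rule field_le_epsilon)
      fix \<delta> :: real assume "0 < \<delta>"
      with sub have "\<forall>\<^sub>F \<epsilon> in at_right 0. trunc_lap s w \<epsilon> y \<le> \<delta> - \<mu> y * w y"
        by (simp add: subsolution_def)
      moreover have "\<forall>\<^sub>F \<epsilon> in at_right 0. \<epsilon> < r \<and> 0 < \<epsilon>"
        by (rule eventually_at_rightI[of 0 r]) (use r in auto)
      ultimately have "\<forall>\<^sub>F \<epsilon> in at_right (0::real). (\<mu> y + \<kappa> / 2 * r powr (- 2 * s)) * w y \<le> T + \<delta>"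
      proof eventually_elim
        case (elim \<epsilon>)
        have "w y * (\<kappa> * r powr (- 2 * s) - B * (\<nu> * r powr (2 - 2 * s))) - T \<le> trunc_lap s w \<epsilon> y"
          unfolding T_def a_def \<kappa>_def \<nu>_def V_def
          by (rule trunc_lap_touching[OF w mw s _ _ _ w0 touch]) (use elim B_def in auto)
        with near elim show ?case by (simp add: algebra_simps)
      qed
      then show "(\<mu> y + \<kappa> / 2 * r powr (- 2 * s)) * w y \<le> T + \<delta>"
        by (simp add: eventually_const)
    qed
    moreover have "T \<le> (3 / (\<theta> * q y)) powr a * (LINT y|lborel. w y * (R + dist x y) powr (- a))"
    proof -
      have "integrable lborel (\<lambda>y'. w y' * (R + dist x y') powr (- a))"
      proof (rule weighted_int_mult_integrable[OF w mw, where C="2 * (1 / R + 1 + norm x / R) powr a"])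
        fix y' :: "real^'n"
        have "norm y' \<le> norm x + (R + dist x y')"
          using norm_triangle_ineq[of x "y' - x"] R by (simp add: dist_norm norm_minus_commute)
        then have "(R + dist x y') powr (- a) * (1 + norm y' powr a) \<le> 2 * (1 / R + 1 + norm x / R) powr a"
          using R a by (intro one_plus_powr_le) auto
        then show "\<bar>(R + dist x y') powr (- a)\<bar> * (1 + norm y' powr (real CARD('n) + 2 * s))
            \<le> 2 * (1 / R + 1 + norm x / R) powr a"
          by (simp add: a_def)
      qed measurable
      then have J: "integrable lborel (\<lambda>z. w (y + z) * (R + dist x (y + z)) powr (- a))"
        by (rule integrable_lborel_shift)
      have "(LINT y'|lborel. w y' * (R + dist x y') powr (- a)) = (LINT z|lborel. w (y + z) * (R + dist x (y + z)) powr (- a))"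
        by (rule integral_lborel_shift) measurable
      moreover have "T \<le> (LINT z|lborel. (3 / (\<theta> * q y)) powr a * (w (y + z) * (R + dist x (y + z)) powr (- a)))"
        unfolding T_def
      proof (rule integral_mono)
        show "integrable lborel (\<lambda>z. (3 / (\<theta> * q y)) powr a * (w (y + z) * (R + dist x (y + z)) powr (- a)))"
          by (rule integrable_mult_right[OF J])
        show "integrable lborel (\<lambda>z. indicator {z. r < norm z} z * (w (y + z) * norm z powr (- a)))"
          unfolding a_def by (rule integrable_shift_tail[OF w mw r(1) s(1)])
        fix z :: "real^'n"
        show "indicator {z. r < norm z} z * (w (y + z) * norm z powr (- a))
          \<le> (3 / (\<theta> * q y)) powr a * (w (y + z) * (R + dist x (y + z)) powr (- a))"
        proof (cases "r < norm z")
          case True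
          define D where "D = 3 / (\<theta> * q y)"
          have D: "D > 0" using \<theta> q by (simp add: D_def)
          \<comment> \<open>Outside the ball of radius \<open>r\<close> the kernel centred at \<open>y\<close> is bounded by
            \<open>D^a (R + |x - (y + z)|)^(-a)\<close>; the weight \<open>q^a\<close> will cancel the factor \<open>(1 / q y)^a\<close>.\<close>
          have "3 * R = D * r" using \<theta> q by (simp add: D_def r_def)
          also have "\<dots> \<le> D * norm z" using True D by (intro mult_left_mono) auto
          finally have 1: "3 * R \<le> D * norm z" .
          have "\<theta> * q y \<le> 1" using \<theta> q by (intro mult_le_one) auto
          then have "3 \<le> D" using \<theta> q by (simp add: D_def le_divide_eq)
          then have "3 * norm z \<le> D * norm z" by (intro mult_right_mono) auto
          moreover have "dist x (y + z) \<le> dist x y + norm z"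
            using dist_triangle[of x "y + z" y] by (simp add: dist_norm)
          ultimately have "R + dist x (y + z) \<le> D * norm z" using 1 dy by linarith
          then have "(D * norm z) powr (- a) \<le> (R + dist x (y + z)) powr (- a)"
            using R a by (intro powr_mono2') (auto intro: add_pos_nonneg)
          then have "D powr a * (D * norm z) powr (- a) \<le> D powr a * (R + dist x (y + z)) powr (- a)"
            by (intro mult_left_mono) auto
          moreover have "D powr a * (D * norm z) powr (- a) = norm z powr (- a)"
            using D by (simp add: powr_mult powr_minus)
          ultimately have "w (y + z) * norm z powr (- a) \<le> w (y + z) * (D powr a * (R + dist x (y + z)) powr (- a))"
            by (intro mult_left_mono w0) simp
          then show ?thesis using True by (simp add: D_def[symmetric] mult.left_commute)
        next
          case False
          then show ?thesis using w0 by simp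
        qed
      qed
      ultimately show ?thesis by simp
    qed
    moreover have "R powr (- 2 * s) \<le> r powr (- 2 * s)"
      using r s R by (intro powr_mono2') auto
    ultimately have main: "(\<mu> y + \<kappa> / 2 * R powr (- 2 * s)) * w y
        \<le> (3 / (\<theta> * q y)) powr a * (LINT y|lborel. w y * (R + dist x y) powr (- a))" (is "_ \<le> _ * ?J")
    proof -
      assume A: "R powr (- 2 * s) \<le> r powr (- 2 * s)"
      have "(\<mu> y + \<kappa> / 2 * R powr (- 2 * s)) * w y \<le> (\<mu> y + \<kappa> / 2 * r powr (- 2 * s)) * w y"
        using A \<kappa> w0 by (intro mult_right_mono add_left_mono mult_left_mono) auto
      moreover assume "(\<mu> y + \<kappa> / 2 * r powr (- 2 * s)) * w y \<le> T" "T \<le> (3 / (\<theta> * q y)) powr a * ?J"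
      ultimately show ?thesis by linarith
    qed
    define m where "m = min 1 (\<kappa> / 2)"
    have m: "0 < m" "m \<le> 1" "m \<le> \<kappa> / 2" using \<kappa> by (auto simp: m_def)
    have "m * ((\<mu> y + R powr (- 2 * s)) * w x) \<le> (\<mu> y + \<kappa> / 2 * R powr (- 2 * s)) * w x"
    proof -
      have "m * \<mu> y \<le> \<mu> y" using m \<mu> by (intro mult_left_le_one_le) auto
      moreover have "m * R powr (- 2 * s) \<le> \<kappa> / 2 * R powr (- 2 * s)" using m by (intro mult_right_mono) auto
      ultimately have "m * (\<mu> y + R powr (- 2 * s)) \<le> \<mu> y + \<kappa> / 2 * R powr (- 2 * s)"
        by (simp add: distrib_left)
      from mult_right_mono[OF this w0[of x]] show ?thesis by (simp add: mult.assoc)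
    qed
    also have "\<dots> \<le> (\<mu> y + \<kappa> / 2 * R powr (- 2 * s)) * (w y * q y powr a)"
      using wx \<mu> \<kappa> by (intro mult_left_mono) (auto intro: add_nonneg_nonneg)
    also have "\<dots> \<le> (3 / (\<theta> * q y)) powr a * ?J * q y powr a"
      using mult_right_mono[OF main, of "q y powr a"] by (simp add: mult.assoc)
    also have "\<dots> = (3 / \<theta>) powr a * ?J"
      using q \<theta> by (simp add: powr_divide powr_mult)
    finally have "(\<mu> y + R powr (- 2 * s)) * w x \<le> C * ?J"
      using m by (simp add: C_def m_def[symmetric] field_simps)
    then show ?thesis using dy by (intro bexI[of _ y]) auto
  qed
  then show ?thesis using C unfolding a_def by blast
qed

section \<open>Powers of solutions are subsolutions\<close>

lemma trunc_lap_Kato: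
  fixes u :: "real^'n \<Rightarrow> real"
  assumes s: "0 < s" and p: "1 \<le> p" and e: "0 < \<epsilon>"
    and u: "u \<in> weighted_int s" "u \<in> borel_measurable borel"
    and w: "(\<lambda>x. \<bar>u x\<bar> powr p) \<in> weighted_int s"
  shows "trunc_lap s (\<lambda>x. \<bar>u x\<bar> powr p) \<epsilon> x \<le> p * \<bar>u x\<bar> powr (p - 1) * sgn (u x) * trunc_lap s u \<epsilon> x"
proof -
  let ?c = "p * \<bar>u x\<bar> powr (p - 1) * sgn (u x)"
  let ?k = "\<lambda>z::real^'n. norm z powr (- (real CARD('n) + 2 * s))"
  have mw: "(\<lambda>x. \<bar>u x\<bar> powr p) \<in> borel_measurable borel"
    using u(2) by measurable
  have "trunc_lap s (\<lambda>x. \<bar>u x\<bar> powr p) \<epsilon> x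
    \<le> (LINT z|lborel. ?c * (indicator {z. \<epsilon> < norm z} z * ((u x - u (x + z)) * ?k z)))"
    unfolding trunc_lap_def
  proof (rule integral_mono)
    fix z :: "real^'n"
    have "(\<bar>u x\<bar> powr p - \<bar>u (x + z)\<bar> powr p) * ?k z \<le> (?c * (u x - u (x + z))) * ?k z"
      by (intro mult_right_mono abs_powr_tangent p) simp
    then show "indicator {z. \<epsilon> < norm z} z * ((\<bar>u x\<bar> powr p - \<bar>u (x + z)\<bar> powr p) * ?k z)
        \<le> ?c * (indicator {z. \<epsilon> < norm z} z * ((u x - u (x + z)) * ?k z))"
      by (auto simp: mult.assoc split: split_indicator)
  qed (intro integrable_mult_right trunc_lap_integrable u w mw e s)+
  then show ?thesis by (simp add: trunc_lap_def)
qed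

lemma subsolution_abs_powr:
  fixes u :: "real^'n \<Rightarrow> real"
  assumes s: "0 < s" and p: "1 \<le> p"
    and u: "u \<in> weighted_int s" "u \<in> borel_measurable borel"
    and w: "(\<lambda>x. \<bar>u x\<bar> powr p) \<in> weighted_int s"
    and lim: "\<And>x. ((\<lambda>\<epsilon>. trunc_lap s u \<epsilon> x) \<longlongrightarrow> - m x * u x) (at_right 0)"
  shows "subsolution s (\<lambda>x. p * m x) (\<lambda>x. \<bar>u x\<bar> powr p)"
  unfolding subsolution_def
proof (intro allI impI)
  fix x and \<delta> :: real assume \<delta>: "0 < \<delta>"
  let ?c = "p * \<bar>u x\<bar> powr (p - 1) * sgn (u x)"
  have "\<bar>u x\<bar> powr (p - 1) * \<bar>u x\<bar> = \<bar>u x\<bar> powr p"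
    by (cases "u x = 0") (auto simp: powr_diff)
  moreover have "sgn (u x) * u x = \<bar>u x\<bar>" by (simp add: sgn_if)
  moreover have "?c * (- m x * u x) = - (p * m x * (\<bar>u x\<bar> powr (p - 1) * (sgn (u x) * u x)))"
    by simp
  ultimately have "?c * (- m x * u x) = - (p * m x * \<bar>u x\<bar> powr p)"
    by simp
  with tendsto_mult_left[OF lim[of x], of ?c]
  have "((\<lambda>\<epsilon>. ?c * trunc_lap s u \<epsilon> x) \<longlongrightarrow> - (p * m x * \<bar>u x\<bar> powr p)) (at_right 0)"
    by (simp only:)
  then have "\<forall>\<^sub>F \<epsilon> in at_right 0. ?c * trunc_lap s u \<epsilon> x < \<delta> - p * m x * \<bar>u x\<bar> powr p"
    by (rule order_tendstoD) (use \<delta> in simp)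
  moreover have "\<forall>\<^sub>F \<epsilon> in at_right (0::real). 0 < \<epsilon>"
    by (rule eventually_at_right_less)
  ultimately show "\<forall>\<^sub>F \<epsilon> in at_right 0. trunc_lap s (\<lambda>x. \<bar>u x\<bar> powr p) \<epsilon> x \<le> \<delta> - p * m x * \<bar>u x\<bar> powr p"
  proof eventually_elim
    case (elim \<epsilon>)
    then show ?case using trunc_lap_Kato[OF s p elim(2) u w, of x] by linarith
  qed
qed

section \<open>Decay at infinity\<close>

lemma powr_weight_le:
  fixes R t a b :: real
  assumes "1 \<le> R" "0 \<le> t" "0 \<le> b" "b \<le> a"
  shows "R powr (a - b) * (R + t) powr (- a) \<le> (R + t) powr (- b)"
proof -
  have "R powr (a - b) * (R + t) powr (- a) \<le> (R + t) powr (a - b) * (R + t) powr (- a)"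
    using assms by (intro mult_right_mono powr_mono2) auto
  then show ?thesis by (simp add: powr_add[symmetric])
qed

lemma integrable_powr_weight:
  fixes w :: "real^'n \<Rightarrow> real"
  assumes [measurable]: "w \<in> borel_measurable borel" and w0: "\<And>y. 0 \<le> w y"
    and int: "integrable lborel (\<lambda>y. w y * (1 + norm y) powr (- b))"
    and b: "0 < b" "b \<le> a" and R: "1 \<le> R"
  shows "integrable lborel (\<lambda>y. w y * (R + norm y) powr (- a))"
proof (rule Bochner_Integration.integrable_bound[OF int])
  show "AE y in lborel. norm (w y * (R + norm y) powr (- a)) \<le> norm (w y * (1 + norm y) powr (- b))"
  proof (rule AE_I2)
    fix y :: "real^'n"
    have "(R + norm y) powr (- a) \<le> (1 + norm y) powr (- a)"
      using b R norm_ge_zero[of y] by (intro powr_mono2') linarith+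
    also have "\<dots> \<le> (1 + norm y) powr (- b)" using b by (intro powr_mono) auto
    finally show "norm (w y * (R + norm y) powr (- a)) \<le> norm (w y * (1 + norm y) powr (- b))"
      using w0[of y] by (simp add: mult_left_mono)
  qed
qed measurable

text \<open>The integrand \<open>R^(a - b) w(y) (R + |y|)^(-a)\<close> is at most \<open>w(y) (R + |y|)^(-b)\<close>, hence dominated
  by \<open>w(y) (1 + |y|)^(-b)\<close> and pointwise convergent to zero, even if \<open>b = a\<close>.\<close>
lemma weighted_average_tendsto_0:
  fixes w :: "real^'n \<Rightarrow> real"
  assumes [measurable]: "w \<in> borel_measurable borel" and w0: "\<And>y. 0 \<le> w y"
    and int: "integrable lborel (\<lambda>y. w y * (1 + norm y) powr (- b))"
    and b: "0 < b" "b \<le> a"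
  shows "((\<lambda>R. R powr (a - b) * (LINT y|lborel. w y * (R + norm y) powr (- a))) \<longlongrightarrow> 0) at_top"
proof -
  let ?g = "\<lambda>R y. R powr (a - b) * (w y * (R + norm y) powr (- a))"
  have le: "?g R y \<le> w y * (R + norm y) powr (- b)" if "1 \<le> R" for R y
    using mult_left_mono[OF powr_weight_le[OF that, of "norm y" b a] w0[of y]] b by (simp add: ac_simps)
  have "((\<lambda>R. LINT y|lborel. ?g R y) \<longlongrightarrow> integral\<^sup>L lborel (\<lambda>y::real^'n. 0)) at_top"
  proof (rule integral_dominated_convergence_at_top[where w="\<lambda>y. w y * (1 + norm y) powr (- b)"])
    show "integrable lborel (\<lambda>y. w y * (1 + norm y) powr (- b))" by (rule int)
    show "\<forall>\<^sub>F R in at_top. AE y in lborel. norm (?g R y) \<le> w y * (1 + norm y) powr (- b)"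
      using eventually_ge_at_top[of 1]
    proof eventually_elim
      case (elim R)
      show ?case
      proof (rule AE_I2)
        fix y :: "real^'n"
        have "(R + norm y) powr (- b) \<le> (1 + norm y) powr (- b)"
          using b elim norm_ge_zero[of y] by (intro powr_mono2') linarith+
        then show "norm (?g R y) \<le> w y * (1 + norm y) powr (- b)"
          using order_trans[OF le[OF elim, of y] mult_left_mono[OF _ w0[of y]]] w0[of y] by simp
      qed
    qed
    show "AE y in lborel. ((\<lambda>R. ?g R y) \<longlongrightarrow> 0) at_top"
    proof (rule AE_I2)
      fix y :: "real^'n"
      show "((\<lambda>R. ?g R y) \<longlongrightarrow> 0) at_top"
      proof (rule tendsto_sandwich[of "\<lambda>_. 0"])
        show "\<forall>\<^sub>F R in at_top. 0 \<le> ?g R y" using w0 by simp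
        show "\<forall>\<^sub>F R in at_top. ?g R y \<le> w y * R powr (- b)"
          using eventually_ge_at_top[of 1]
        proof eventually_elim
          case (elim R)
          have "(R + norm y) powr (- b) \<le> R powr (- b)"
            using b elim norm_ge_zero[of y] by (intro powr_mono2') linarith+
          from order_trans[OF le[OF elim, of y] mult_left_mono[OF this w0[of y]]] show ?case .
        qed
        show "((\<lambda>R. w y * R powr (- b)) \<longlongrightarrow> 0) at_top"
          using b by (intro tendsto_mult_right_zero tendsto_neg_powr filterlim_ident) auto
      qed auto
    qed
  qed measurable
  then show ?thesis by simp
qed

text \<open>The local bound with \<open>R = |x| / 2\<close>: the ball around \<open>x\<close> lies in \<open>R \<le> |y| \<le> 3 R\<close>.  The hypothesis
  \<open>absorb\<close> is a lower bound \<open>k R^(-e)\<close> for the factor of \<open>w x\<close> there; it may come from the kernel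
  (\<open>e = 2 s\<close>) or from the coefficient \<open>\<mu>\<close>.\<close>
lemma subsolution_tendsto_0:
  fixes w :: "real^'n \<Rightarrow> real"
  assumes s: "0 < s" "s < 1"
    and cont: "continuous_on UNIV w" and w: "w \<in> weighted_int s" and w0: "\<And>y. 0 \<le> w y"
    and \<mu>: "\<And>y. 0 \<le> \<mu> y" and sub: "subsolution s \<mu> w"
    and int: "integrable lborel (\<lambda>y. w y * (1 + norm y) powr (- b))"
    and b: "0 < b" "b \<le> real CARD('n) + 2 * s"
    and k: "0 < k" "e \<le> real CARD('n) + 2 * s - b"
    and absorb: "\<And>R y. 1 \<le> R \<Longrightarrow> R \<le> norm y \<Longrightarrow> norm y \<le> 3 * R \<Longrightarrow> k * R powr (- e) \<le> \<mu> y + R powr (- 2 * s)"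
  shows "(w \<longlongrightarrow> 0) at_infinity"
proof -
  define a where "a = real CARD('n) + 2 * s"
  have a: "0 < a" using s by (simp add: a_def add_nonneg_pos)
  have mw[measurable]: "w \<in> borel_measurable borel"
    using cont by (rule borel_measurable_continuous_onI)
  define J where "J = (\<lambda>R. LINT y|lborel. w y * (R + norm y) powr (- a))"
  obtain C where C: "C > 0" and bound: "\<And>(w :: real^'n \<Rightarrow> real) \<mu> x R. 0 < R \<Longrightarrow> continuous_on UNIV w \<Longrightarrow> w \<in> weighted_int s \<Longrightarrow>
    (\<forall>y. 0 \<le> w y) \<Longrightarrow> (\<forall>y. 0 \<le> \<mu> y) \<Longrightarrow> subsolution s \<mu> w \<Longrightarrow>
    (\<exists>y\<in>ball x R. (\<mu> y + R powr (- 2 * s)) * w x \<le> C * (LINT y|lborel. w y * (R + dist x y) powr (- a)))"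
    using subsolution_local_bound[OF s, where 'n='n] unfolding a_def by blast
  define A where "A = C * 3 powr a / k"
  have bnd: "w x \<le> A * ((norm x / 2) powr (a - b) * J (norm x / 2))" if x: "2 \<le> norm x" for x
  proof -
    define R where "R = norm x / 2"
    have R: "1 \<le> R" "norm x = 2 * R" using x by (auto simp: R_def)
    have "0 < R" using R by simp
    then obtain y where y: "dist x y < R"
      and main: "(\<mu> y + R powr (- 2 * s)) * w x \<le> C * (LINT y|lborel. w y * (R + dist x y) powr (- a))"
      using bound[of R w \<mu> x] cont w w0 \<mu> sub by auto
    have "norm x \<le> norm y + dist x y" "norm y \<le> norm x + dist x y"
      using norm_triangle_ineq2[of x y] norm_triangle_ineq2[of y x] by (auto simp: dist_norm norm_minus_commute)
    then have "k * R powr (- e) \<le> \<mu> y + R powr (- 2 * s)"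
      using y R by (intro absorb) auto
    then have "k * R powr (- e) * w x \<le> (\<mu> y + R powr (- 2 * s)) * w x"
      by (intro mult_right_mono w0)
    also have "\<dots> \<le> C * (LINT y|lborel. w y * (R + dist x y) powr (- a))" by (rule main)
    also have "\<dots> \<le> C * (LINT y|lborel. 3 powr a * (w y * (R + norm y) powr (- a)))"
    proof (intro mult_left_mono integral_mono' integrable_mult_right)
      show "integrable lborel (\<lambda>y. w y * (R + norm y) powr (- a))"
        using b R by (intro integrable_powr_weight[OF mw w0 int]) (auto simp: a_def)
      fix y :: "real^'n"
      have "norm y \<le> norm x + dist x y"
        using norm_triangle_ineq2[of y x] by (simp add: dist_norm norm_minus_commute)
      then have "R + norm y \<le> 3 * (R + dist x y)" using R(2) zero_le_dist[of x y] by argo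
      then have "(3 * (R + dist x y)) powr (- a) \<le> (R + norm y) powr (- a)"
        using a R by (intro powr_mono2') (auto intro: add_pos_nonneg)
      then have "3 powr a * (3 * (R + dist x y)) powr (- a) \<le> 3 powr a * (R + norm y) powr (- a)"
        by (intro mult_left_mono) auto
      moreover have "3 powr a * (3 * (R + dist x y)) powr (- a) = (R + dist x y) powr (- a)"
        using R by (simp add: powr_mult powr_minus del: distrib_left_numeral)
      ultimately have "w y * (R + dist x y) powr (- a) \<le> w y * (3 powr a * (R + norm y) powr (- a))"
        by (intro mult_left_mono w0) (simp only:)
      then show "w y * (R + dist x y) powr (- a) \<le> 3 powr a * (w y * (R + norm y) powr (- a))"
        by (simp add: mult.left_commute)
    qed (use C w0 in auto)
    also have "\<dots> = C * 3 powr a * J R" by (simp add: J_def)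
    finally have "R powr e * (k * R powr (- e) * w x) \<le> R powr e * (C * 3 powr a * J R)"
      by (intro mult_left_mono) auto
    moreover have "R powr e * (k * R powr (- e) * w x) = k * w x"
      using \<open>0 < R\<close> by (simp add: powr_minus)
    ultimately have "k * w x \<le> R powr e * (C * 3 powr a * J R)" by linarith
    then have "w x \<le> R powr e * (C * 3 powr a * J R) / k"
      using k(1) by (simp add: pos_le_divide_eq mult.commute)
    also have "\<dots> = A * (R powr e * J R)" by (simp add: A_def)
    finally have "w x \<le> A * (R powr e * J R)" .
    also have "\<dots> \<le> A * (R powr (a - b) * J R)"
    proof (intro mult_left_mono mult_right_mono powr_mono)
      show "0 \<le> J R" unfolding J_def using w0 by (intro integral_nonneg_AE) auto
    qed (use k R C in \<open>auto simp: A_def a_def\<close>)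
    finally show ?thesis by (simp add: R_def)
  qed
  have "((\<lambda>R. A * (R powr (a - b) * J R)) \<longlongrightarrow> 0) at_top"
    unfolding J_def using b
    by (intro tendsto_mult_right_zero weighted_average_tendsto_0[OF mw w0 int]) (auto simp: a_def)
  moreover have "filterlim (\<lambda>x::real^'n. norm x / 2) at_top at_infinity"
    using filterlim_tendsto_pos_mult_at_top[OF tendsto_const[of "1/2::real"] _ filterlim_norm_at_top]
    by simp
  ultimately have lim: "((\<lambda>x::real^'n. A * ((norm x / 2) powr (a - b) * J (norm x / 2))) \<longlongrightarrow> 0) at_infinity"
    by (rule filterlim_compose)
  show ?thesis
  proof (rule tendsto_sandwich[OF _ _ tendsto_const lim])
    show "\<forall>\<^sub>F x in at_infinity. w x \<le> A * ((norm x / 2) powr (a - b) * J (norm x / 2))"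
      using bnd by (auto simp: eventually_at_infinity)
  qed (use w0 in auto)
qed

section \<open>The maximum principle\<close>

lemma subsolution_maximum_principle:
  fixes w :: "real^'n \<Rightarrow> real"
  assumes cont: "continuous_on UNIV w" and w0: "\<And>y. 0 \<le> w y" and \<mu>: "\<And>y. 0 < \<mu> y"
    and sub: "subsolution s \<mu> w" and lim: "(w \<longlongrightarrow> 0) at_infinity"
  shows "w x = 0"
proof (rule ccontr)
  assume "w x \<noteq> 0"
  then have wx: "0 < w x" using w0[of x] by simp
  then have "\<forall>\<^sub>F y in at_infinity. w y < w x" using lim by (intro order_tendstoD)
  then obtain r where r: "\<And>y. r \<le> norm y \<Longrightarrow> w y < w x" by (auto simp: eventually_at_infinity)
  have "\<exists>y\<in>cball 0 (max r (norm x)). \<forall>y'\<in>cball 0 (max r (norm x)). w y' \<le> w y"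
    using cont by (intro continuous_attains_sup) (auto intro: continuous_on_subset simp: not_less le_max_iff_disj)
  then obtain y where "\<forall>y'\<in>cball 0 (max r (norm x)). w y' \<le> w y" by blast
  then have y: "w y' \<le> w y" if "norm y' \<le> max r (norm x)" for y'
    using that by simp
  have xy: "w x \<le> w y" by (rule y) simp
  have max: "w y' \<le> w y" for y'
    using y[of y'] r[of y'] xy by (cases "norm y' \<le> max r (norm x)") (auto simp: le_max_iff_disj)
  have pos: "0 < \<mu> y * w y" using \<mu> wx xy by simp
  have "\<forall>\<^sub>F \<epsilon> in at_right 0. trunc_lap s w \<epsilon> y \<le> \<mu> y * w y / 2 - \<mu> y * w y"
    using sub half_gt_zero[OF pos] unfolding subsolution_def by blast
  then obtain \<epsilon> where "trunc_lap s w \<epsilon> y \<le> \<mu> y * w y / 2 - \<mu> y * w y"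
    using eventually_happens[of _ "at_right (0::real)"] by (auto simp: trivial_limit_at_right_real)
  then have "trunc_lap s w \<epsilon> y < 0" using pos by linarith
  moreover have "0 \<le> trunc_lap s w \<epsilon> y"
    unfolding trunc_lap_def using max by (intro integral_nonneg_AE) (auto intro!: mult_nonneg_nonneg)
  ultimately show False by simp
qed

section \<open>Solutions of the equation\<close>

lemma holder_on_UNIV_continuous:
  assumes "holder_on \<sigma> UNIV f" "0 < \<sigma>"
  shows "continuous_on UNIV f"
proof -
  obtain C where C: "\<And>x y. dist (f x) (f y) \<le> C * dist x y powr \<sigma>"
    using assms(1) by (auto simp: holder_on_def)
  have "(f \<longlongrightarrow> f x) (at x)" for x
  proof (subst tendsto_dist_iff, rule tendsto_sandwich[of "\<lambda>_. 0"])
    show "\<forall>\<^sub>F y in at x. dist (f y) (f x) \<le> C * dist y x powr \<sigma>" using C by simp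
    have "((\<lambda>y. C * dist y x powr \<sigma>) \<longlongrightarrow> C * dist x x powr \<sigma>) (at x)"
      using assms(2) by (intro tendsto_intros tendsto_powr') auto
    then show "((\<lambda>y. C * dist y x powr \<sigma>) \<longlongrightarrow> 0) (at x)" using assms(2) by simp
  qed auto
  then show ?thesis by (simp add: continuous_on_def)
qed

lemma is_solution_continuous:
  assumes "is_solution s \<rho> c u" "0 < s"
  shows "continuous_on UNIV u"
proof -
  obtain \<gamma> where \<gamma>: "\<gamma> > 0" "if s < 1/2 then 2 * s + \<gamma> \<le> 1 \<and> holder_on (2 * s + \<gamma>) UNIV u
             else 2 * s + \<gamma> - 1 \<le> 1 \<and> C1_holder_loc (2 * s + \<gamma> - 1) u"
    using assms by (auto simp: is_solution_def)
  show ?thesis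
  proof (cases "s < 1/2")
    case True
    then show ?thesis using \<gamma> assms(2) by (intro holder_on_UNIV_continuous[of "2 * s + \<gamma>"]) auto
  next
    case False
    then obtain g where "\<And>x. GDERIV u x :> g x" using \<gamma> by (auto simp: C1_holder_loc_def)
    then show ?thesis
      by (auto simp: gderiv_def continuous_on_eq_continuous_at intro: has_derivative_continuous)
  qed
qed

lemma frac_const_nonneg: "0 \<le> frac_const TYPE('n::finite) s"
  unfolding frac_const_def by (auto intro!: integral_nonneg_AE)

lemma is_solution_trunc_lap_tendsto:
  assumes sol: "is_solution s \<rho> c u" and m: "u \<in> borel_measurable borel"
    and C: "frac_const TYPE('n) s \<noteq> 0"
  shows "((\<lambda>\<epsilon>. trunc_lap s u \<epsilon> x) \<longlongrightarrow> - (\<rho> x * c x / frac_const TYPE('n) s) * u (x :: real^'n)) (at_right 0)"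
proof -
  obtain l where lap: "has_frac_laplacian s u x l" and "l + \<rho> x * c x * u x = 0"
    using sol by (auto simp: is_solution_def)
  then have l: "l = - (\<rho> x * c x * u x)" by linarith
  from lap have "((\<lambda>\<epsilon>. frac_const TYPE('n) s * trunc_lap s u \<epsilon> x) \<longlongrightarrow> - (\<rho> x * c x * u x)) (at_right 0)"
    unfolding has_frac_laplacian_def LINT_eq_trunc_lap[OF m] l .
  from tendsto_mult_left[OF this, of "1 / frac_const TYPE('n) s"] show ?thesis
    using C by simp
qed

text \<open>The normalising constant is the inverse of an integral, and it would be \<open>0\<close> if that integral
  vanished or diverged.  This possibility need not be excluded: with the constant \<open>0\<close> the equation
  reduces to \<open>\<rho> c u = 0\<close>.\<close>
lemma is_solution_degenerate_const:
  assumes "is_solution s \<rho> c u" "frac_const TYPE('n) s = 0" "0 < \<rho> x" "0 < c x"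
  shows "u (x :: real^'n) = 0"
proof -
  obtain l where l: "has_frac_laplacian s u x l" "l + \<rho> x * c x * u x = 0"
    using assms by (auto simp: is_solution_def)
  then have "((\<lambda>\<epsilon>::real. 0::real) \<longlongrightarrow> l) (at_right 0)"
    using assms(2) by (simp add: has_frac_laplacian_def)
  then have "l = 0" by (simp add: tendsto_const_iff)
  then show ?thesis using l assms by simp
qed

lemma powr_lower_bound_annulus:
  fixes R t \<alpha> :: real
  assumes "1 \<le> R" "R \<le> t" "t \<le> 3 * R"
  shows "min 1 (10 powr (- \<alpha> / 2)) * R powr (- \<alpha>) \<le> (1 + t\<^sup>2) powr (- \<alpha> / 2)"
proof -
  have R2: "R\<^sup>2 powr (- \<alpha> / 2) = R powr (- \<alpha>)"
    using assms by (simp add: powr_numeral[symmetric] powr_powr del: powr_numeral)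
  have t2: "R\<^sup>2 \<le> t\<^sup>2" "t\<^sup>2 \<le> 9 * R\<^sup>2" "1 \<le> R\<^sup>2"
    using power_mono[of R t 2] power_mono[of t "3 * R" 2] power_mono[of 1 R 2] assms
    by (auto simp: power_mult_distrib)
  show ?thesis
  proof (cases "\<alpha> \<ge> 0")
    case True
    have "min 1 (10 powr (- \<alpha> / 2)) * R powr (- \<alpha>) \<le> 10 powr (- \<alpha> / 2) * R\<^sup>2 powr (- \<alpha> / 2)"
      unfolding R2 by (intro mult_right_mono) auto
    also have "\<dots> = (10 * R\<^sup>2) powr (- \<alpha> / 2)" by (simp add: powr_mult)
    also have "\<dots> \<le> (1 + t\<^sup>2) powr (- \<alpha> / 2)"
    proof (rule powr_mono2')
      show "0 < 1 + t\<^sup>2" by (simp add: add_pos_nonneg)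
      show "1 + t\<^sup>2 \<le> 10 * R\<^sup>2" using t2 by linarith
    qed (use True in simp)
    finally show ?thesis .
  next
    case False
    have "min 1 (10 powr (- \<alpha> / 2)) * R powr (- \<alpha>) \<le> 1 * R\<^sup>2 powr (- \<alpha> / 2)"
      unfolding R2 by (intro mult_right_mono) auto
    also have "\<dots> \<le> (1 + t\<^sup>2) powr (- \<alpha> / 2)"
      using False t2 by (simp add: powr_mono2)
    finally show ?thesis .
  qed
qed

lemma weighted_Lp_integrable:
  fixes u :: "real^'n \<Rightarrow> real"
  assumes u: "u \<in> weighted_Lp p (poly_weight \<beta>)" and [measurable]: "u \<in> borel_measurable borel" and \<beta>: "0 < \<beta>"
  shows "integrable lborel (\<lambda>y. \<bar>u y\<bar> powr p * (1 + norm y) powr (- \<beta>))"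
proof (rule Bochner_Integration.integrable_bound)
  have "integrable lebesgue (\<lambda>y. \<bar>u y\<bar> powr p * poly_weight \<beta> y)"
    using u by (simp add: weighted_Lp_def)
  then show "integrable lborel (\<lambda>y. \<bar>u y\<bar> powr p * poly_weight \<beta> y)"
    by (subst (asm) integrable_completion) (auto simp: poly_weight_def)
  show "AE y in lborel. norm (\<bar>u y\<bar> powr p * (1 + norm y) powr (- \<beta>)) \<le> norm (\<bar>u y\<bar> powr p * poly_weight \<beta> y)"
  proof (rule AE_I2)
    fix y :: "real^'n"
    have pos: "0 < 1 + norm y" by (simp add: add_pos_nonneg)
    have "(1 + norm y) powr (- \<beta>) = ((1 + norm y)\<^sup>2) powr (- \<beta> / 2)"
      using pos by (simp add: powr_numeral[symmetric] powr_powr del: powr_numeral)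
    also have "\<dots> \<le> (1 + (norm y)\<^sup>2) powr (- \<beta> / 2)"
      using \<beta> by (intro powr_mono2') (auto simp: power2_sum add_pos_nonneg)
    finally have "(1 + norm y) powr (- \<beta>) \<le> poly_weight \<beta> y" by (simp add: poly_weight_def)
    then show "norm (\<bar>u y\<bar> powr p * (1 + norm y) powr (- \<beta>)) \<le> norm (\<bar>u y\<bar> powr p * poly_weight \<beta> y)"
      by (simp add: abs_mult mult_left_mono poly_weight_def)
  qed
qed measurable

lemma weighted_int_integrable:
  fixes v :: "real^'n \<Rightarrow> real"
  assumes v: "v \<in> weighted_int s" and m: "v \<in> borel_measurable borel" and s: "0 < s"
  shows "integrable lborel (\<lambda>y. v y * (1 + norm y) powr (- (real CARD('n) + 2 * s)))"
proof (rule weighted_int_mult_integrable[OF v m])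
  fix y :: "real^'n"
  show "\<bar>(1 + norm y) powr (- (real CARD('n) + 2 * s))\<bar> * (1 + norm y powr (real CARD('n) + 2 * s))
     \<le> 2 * (1 / 1 + 1 + 0 / 1) powr (real CARD('n) + 2 * s)"
    unfolding abs_of_nonneg[OF powr_ge_zero] using s by (intro one_plus_powr_le) auto
qed measurable

theorem theorem2p8:
  fixes s \<alpha> \<beta> :: real
  assumes "0 < s" and "s < 1" and "0 < \<beta>"
  shows "\<exists>\<Lambda>>0. \<forall>(p::real) (K::real) (c\<^sub>0::real)
           (\<rho> :: real^'n \<Rightarrow> real) (c :: real^'n \<Rightarrow> real) (u :: real^'n \<Rightarrow> real).
     1 \<le> p \<longrightarrow> 0 < K \<longrightarrow> 0 < c\<^sub>0 \<longrightarrow>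
     continuous_on UNIV \<rho> \<longrightarrow> (\<forall>x. 0 < \<rho> x) \<longrightarrow>
     continuous_on UNIV c \<longrightarrow> (\<forall>x. 0 \<le> c x) \<longrightarrow> (\<forall>x. c\<^sub>0 \<le> c x) \<longrightarrow>
     is_solution s \<rho> c u \<longrightarrow>
     (\<lambda>x. \<bar>u x\<bar> powr p) \<in> weighted_int s \<longrightarrow>
     u \<in> weighted_Lp p (poly_weight \<beta>) \<longrightarrow>
     (let N = real CARD('n);
          lower = (\<forall>x. K * (1 + (norm x)\<^sup>2) powr (- \<alpha> / 2) \<le> \<rho> x);
          lower_log = (\<forall>x. K * (1 + (norm x)\<^sup>2) powr (- s) * ln (1 + (norm x)\<^sup>2) \<le> \<rho> x)
      in (\<beta> \<le> N - 2 * s \<and> lower) \<or>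
         (\<Lambda> < p * c\<^sub>0 * K \<and>
           ((N - 2 * s < \<beta> \<and> \<beta> < N \<and> \<alpha> \<le> 2 * s \<and> lower) \<or>
            (\<beta> = N \<and> ((\<alpha> < 2 * s \<and> lower) \<or> lower_log)) \<or>
            (N < \<beta> \<and> \<alpha> + \<beta> \<le> 2 * s + N \<and> lower)))) \<longrightarrow>
     (\<forall>x. u x = 0)"
  \<comment> \<open>The decay of \<open>|u|^p\<close> holds with some implied constant for every positive value of \<open>p c\<^sub>0 K\<close>;
    hence \<open>\<Lambda> = 1\<close> is a witness.\<close>
proof (intro exI[of _ 1] conjI allI impI zero_less_one)
  fix p K c\<^sub>0 :: real and \<rho> c u :: "real^'n \<Rightarrow> real" and x :: "real^'n"
  assume p: "1 \<le> p" and K: "0 < K" and c0: "0 < c\<^sub>0" and \<rho>: "\<forall>x. 0 < \<rho> x" and c: "\<forall>x. c\<^sub>0 \<le> c x"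
    and sol: "is_solution s \<rho> c u" and w: "(\<lambda>x. \<bar>u x\<bar> powr p) \<in> weighted_int s"
    and Lp: "u \<in> weighted_Lp p (poly_weight \<beta>)"
    and cases: "let N = real CARD('n);
          lower = (\<forall>x. K * (1 + (norm x)\<^sup>2) powr (- \<alpha> / 2) \<le> \<rho> x);
          lower_log = (\<forall>x. K * (1 + (norm x)\<^sup>2) powr (- s) * ln (1 + (norm x)\<^sup>2) \<le> \<rho> x)
      in (\<beta> \<le> N - 2 * s \<and> lower) \<or>
         (1 < p * c\<^sub>0 * K \<and>
           ((N - 2 * s < \<beta> \<and> \<beta> < N \<and> \<alpha> \<le> 2 * s \<and> lower) \<or>
            (\<beta> = N \<and> ((\<alpha> < 2 * s \<and> lower) \<or> lower_log)) \<or>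
            (N < \<beta> \<and> \<alpha> + \<beta> \<le> 2 * s + N \<and> lower)))"
  note s = assms(1,2) and \<beta> = assms(3)
  have c_pos: "0 < c y" for y using c c0 less_le_trans by blast
  define N where "N = real CARD('n)"
  have alternatives: "\<beta> \<le> N \<or> (N < \<beta> \<and> \<alpha> + \<beta> \<le> 2 * s + N \<and> (\<forall>x. K * (1 + (norm x)\<^sup>2) powr (- \<alpha> / 2) \<le> \<rho> x))"
    using cases s unfolding Let_def N_def by argo
  show "u x = 0"
  proof (cases "frac_const TYPE('n) s = 0")
    case True
    then show ?thesis using is_solution_degenerate_const sol \<rho> c_pos by blast
  next
    case False
    define \<kappa> where "\<kappa> = frac_const TYPE('n) s"
    have \<kappa>: "0 < \<kappa>" using False frac_const_nonneg[of s, where 'n='n] by (simp add: \<kappa>_def)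
    define \<mu> where "\<mu> = (\<lambda>y. p * (\<rho> y * c y / \<kappa>))"
    define W where "W = (\<lambda>y. \<bar>u y\<bar> powr p)"
    have cont: "continuous_on UNIV u" using is_solution_continuous[OF sol s(1)] .
    then have m: "u \<in> borel_measurable borel" by (rule borel_measurable_continuous_onI)
    have contW: "continuous_on UNIV W"
      unfolding W_def using cont p by (intro continuous_on_powr' continuous_intros) auto
    have mW: "W \<in> borel_measurable borel" using contW by (rule borel_measurable_continuous_onI)
    have W0: "0 \<le> W y" for y by (simp add: W_def)
    have w': "W \<in> weighted_int s" using w by (simp add: W_def)
    have \<mu>_pos: "0 < \<mu> y" for y using p \<rho> c_pos[of y] \<kappa> by (simp add: \<mu>_def)
    have "u \<in> weighted_int s" using sol by (simp add: is_solution_def)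
    then have sub: "subsolution s \<mu> W"
      unfolding \<mu>_def W_def \<kappa>_def
      by (rule subsolution_abs_powr[OF s(1) p _ m w is_solution_trunc_lap_tendsto[OF sol m False]])
    have intW: "integrable lborel (\<lambda>y. W y * (1 + norm y) powr (- \<beta>))"
      unfolding W_def by (rule weighted_Lp_integrable[OF Lp m \<beta>])
    have "(W \<longlongrightarrow> 0) at_infinity"
      using alternatives
    proof (elim disjE conjE)
      assume "\<beta> \<le> N"
      then show ?thesis
        using s \<beta> \<mu>_pos
        by (intro subsolution_tendsto_0[OF s contW w' W0 _ sub intW, where k=1 and e="2 * s"])
           (auto simp: N_def less_imp_le)
    next
      assume *: "N < \<beta>" "\<alpha> + \<beta> \<le> 2 * s + N"
        and lower: "\<forall>x. K * (1 + (norm x)\<^sup>2) powr (- \<alpha> / 2) \<le> \<rho> x"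
      \<comment> \<open>For \<open>\<beta> > N + 2 s\<close> the weighted space of \<open>|u|^p\<close> gives better integrability than \<open>\<psi>\<close>.\<close>
      define b where "b = min \<beta> (N + 2 * s)"
      have b: "0 < b" "b \<le> N + 2 * s" "\<alpha> \<le> N + 2 * s - b"
        using * s \<beta> by (auto simp: b_def N_def min_def add_nonneg_pos)
      have intb: "integrable lborel (\<lambda>y. W y * (1 + norm y) powr (- b))"
        using intW weighted_int_integrable[OF w' mW s(1)] by (simp add: b_def min_def N_def)
      define k where "k = p * (K * c\<^sub>0 / \<kappa>) * min 1 (10 powr (- \<alpha> / 2))"
      have k: "0 < k" using p K c0 \<kappa> by (simp add: k_def)
      have absorb: "k * R powr (- \<alpha>) \<le> \<mu> y + R powr (- 2 * s)"
        if "1 \<le> R" "R \<le> norm y" "norm y \<le> 3 * R" for R and y :: "real^'n"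
      proof -
        have "k * R powr (- \<alpha>) \<le> p * (K * c\<^sub>0 / \<kappa>) * (1 + (norm y)\<^sup>2) powr (- \<alpha> / 2)"
          unfolding k_def mult.assoc[of _ "min _ _"] using p K c0 \<kappa> that
          by (intro mult_left_mono powr_lower_bound_annulus) auto
        also have "\<dots> = p * ((K * (1 + (norm y)\<^sup>2) powr (- \<alpha> / 2)) * c\<^sub>0 / \<kappa>)" by simp
        also have "\<dots> \<le> \<mu> y"
          unfolding \<mu>_def using p c0 c \<kappa> lower \<rho>
          by (intro mult_left_mono divide_right_mono mult_mono) (auto simp: less_imp_le)
        finally show ?thesis by (simp add: add_increasing2)
      qed
      show ?thesis
        using b \<mu>_pos
        by (intro subsolution_tendsto_0[OF s contW w' W0 _ sub intb _ _ k _ absorb]) (auto simp: N_def less_imp_le)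
    qed
    then have "W x = 0" by (rule subsolution_maximum_principle[OF contW W0 \<mu>_pos sub])
    then show ?thesis by (simp add: W_def)
  qed
qed

end
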